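(* Consider the problem of minimizing $f(x)=\sum_{i=1}^Nf^{[i]}(x)$ subject to $g(x)\le0$, $h(x)=0$, $x\in X$ (all local constraint sets equal to $X$), under the Slater condition. Let the non-degeneracy, balanced communication and periodic strong connectivity assumptions hold, and let the step-sizes satisfy the step-size assumption. Then for the sequences $\{x^{[i]}(k)\}$, $\{y^{[i]}(k)\}$ of the DPPDS algorithm there exists a primal optimal solution $\tilde x\in X^*$ such that $\lim_{k\to\infty}\|x^{[i]}(k)-\tilde x\|=0$ for all $i\in V$, and $\lim_{k\to\infty}|y^{[i]}(k)-p^*|=0$ for all $i\in V$.
   Context: Agents $V=\{1,\dots,N\}$; $f^{[i]}:\mathbb{R}^n\to\mathbb{R}$ convex; $X\subseteq\mathbb{R}^n$ nonempty compact convex; $g:\mathbb{R}^n\to\mathbb{R}^m$ with convex components; $h(x)=Ax-b$, $h_\ell(x)=a_\ell^Tx-b_\ell$, $\ell=1,\dots,\nu$; feasible set nonempty, $p^*$ optimal value, $X^*$ optimal set. Slater: exists $\bar x\in X$ with $g(\bar x)<0$, $h(\bar x)=0$, and a relative interior point $\tilde x$ of $X$ with $h(\tilde x)=0$. Network weights $a^i_j(k)\ge0$, $E(k)=\{(j,i):j\ne i,a^i_j(k)>0\}$; non-degeneracy: some $\eta>0$ with $a^i_i(k)\ge\eta$, $a^i_j(k)\in\{0\}\cup[\eta,1]$ for $i\neq j$; balanced: $\sum_ja^i_j(k)=1$, $\sum_ia^i_j(k)=1$; periodic strong connectivity: some integer $B\ge1$ with $(V,\bigcup_{k=0}^{B-1}E(k_0+k))$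 strongly connected for all $k_0$. Step-size assumption: $\alpha(k)>0$, $s(k):=\sum_{\ell=0}^k\alpha(\ell)$, $\alpha(k)\to0$, $\sum\alpha(k)=\infty$, $\sum\alpha(k)^2<\infty$, $\alpha(k+1)s(k)\to0$, $\sum_k\alpha(k+1)^2s(k)<\infty$, $\sum_k\alpha(k+1)^2s(k)^2<\infty$. DPPDS algorithm: $x^{[i]}(0)\in X$, $\mu^{[i]}(0)\in\mathbb{R}^m_{\ge0}$, $\lambda^{[i]}(0)\in\mathbb{R}^\nu_{\ge0}$, $y^{[i]}(1)=Nf^{[i]}(x^{[i]}(0))$; for $k\ge0$, $v^{[i]}_z(k)=\sum_ja^i_j(k)z^{[j]}(k)$ for $z\in\{x,y,\mu,\lambda\}$; $x^{[i]}(k+1)=P_X[v^{[i]}_x(k)-\alpha(k)\mathcal{S}^{[i]}_x(k)]$; $\mu^{[i]}(k+1)=v^{[i]}_\mu(k)+\alpha(k)[g(v^{[i]}_x(k))]^+$; $\lambda^{[i]}(k+1)=v^{[i]}_\lambda(k)+\alpha(k)|h(v^{[i]}_x(k))|$; for $k\ge1$, $y^{[i]}(k+1)=v^{[i]}_y(k)+N(f^{[i]}(x^{[i]}(k))-f^{[i]}(x^{[i]}(k-1)))$. Here $P_X$ is Euclidean projection, $[\cdot]^+$ componentwise positive part, $|\cdot|$ componentwise absolute value, and $\mathcal{S}^{[i]}_x(k)=\mathcal{D}f^{[i]}(v^{[i]}_x(k))+\sum_{\ell=1}^mv^{[i]}_\mu(k)_\ell\,\mathcal{D}[g_\ell]^+(v^{[i]}_x(k))+\sum_{\ell=1}^\nu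 v^{[i]}_\lambda(k)_\ell\,\mathcal{D}|h_\ell|(v^{[i]}_x(k))$, where $\mathcal{D}F(z)$ denotes a subgradient of the convex function $F$ at $z$. *)

theory Defs
  imports "HOL-Analysis.Analysis"
begin

text \<open>d is a subgradient of the convex function F at z.\<close>
definition is_subgradient :: "('a::real_inner \<Rightarrow> real) \<Rightarrow> 'a \<Rightarrow> 'a \<Rightarrow> bool" where
  "is_subgradient F z d \<longleftrightarrow> (\<forall>w. F w \<ge> F z + inner d (w - z))"

text \<open>Feasible set, optimal value p*, optimal set X* of
  min sum_i f_i(x) s.t. g_l(x) <= 0 (l < m), h_l(x) = 0 (l < nu), x in X.\<close>
definition feasible_set ::
  "'a set \<Rightarrow> nat \<Rightarrow> (nat \<Rightarrow> 'a \<Rightarrow> real) \<Rightarrow> nat \<Rightarrow> (nat \<Rightarrow> 'a \<Rightarrow> real) \<Rightarrow> 'a set" where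
  "feasible_set X m g \<nu> h = {x\<in>X. (\<forall>l<m. g l x \<le> 0) \<and> (\<forall>l<\<nu>. h l x = 0)}"

definition opt_value ::
  "nat \<Rightarrow> (nat \<Rightarrow> 'a \<Rightarrow> real) \<Rightarrow> 'a set \<Rightarrow> nat \<Rightarrow> (nat \<Rightarrow> 'a \<Rightarrow> real) \<Rightarrow> nat \<Rightarrow> (nat \<Rightarrow> 'a \<Rightarrow> real) \<Rightarrow> real" where
  "opt_value N fi X m g \<nu> h = (INF x\<in>feasible_set X m g \<nu> h. (\<Sum>i<N. fi i x))"

definition opt_set ::
  "nat \<Rightarrow> (nat \<Rightarrow> 'a \<Rightarrow> real) \<Rightarrow> 'a set \<Rightarrow> nat \<Rightarrow> (nat \<Rightarrow> 'a \<Rightarrow> real) \<Rightarrow> nat \<Rightarrow> (nat \<Rightarrow> 'a \<Rightarrow> real) \<Rightarrow> 'a set" where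
  "opt_set N fi X m g \<nu> h =
     {x\<in>feasible_set X m g \<nu> h. (\<Sum>i<N. fi i x) = opt_value N fi X m g \<nu> h}"

text \<open>Communication graph at time k: edge (j,i) with j \<noteq> i iff a^i_j(k) > 0,
  where the weight a^i_j(k) is written  a k i j.\<close>
definition comm_edges :: "nat \<Rightarrow> (nat \<Rightarrow> nat \<Rightarrow> nat \<Rightarrow> real) \<Rightarrow> nat \<Rightarrow> (nat \<times> nat) set" where
  "comm_edges N a k = {(j, i). j < N \<and> i < N \<and> j \<noteq> i \<and> a k i j > 0}"

text \<open>A directed graph on vertex set {0..<N} is strongly connected.\<close>
definition strongly_connected_on :: "nat \<Rightarrow> (nat \<times> nat) set \<Rightarrow> bool" where
  "strongly_connected_on N E \<longleftrightarrow> (\<forall>i<N. \<forall>j<N. (i, j) \<in> E\<^sup>*)"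

end

theory Submission
  imports Defs
begin

text \<open>
  The constraints \<open>g \<le> 0\<close> and \<open>h = 0\<close> enter only through the nonnegative convex functions
  \<open>max 0 g\<close> and \<open>\<bar>h\<bar>\<close>, which are treated as one family \<open>q\<close>. Instead of Lagrange duality, the
  Slater condition is used for a linear error bound: the distance from a point of \<open>X\<close> to the
  feasible set is at most a constant times its total violation. Hence a large fixed multiplier makes
  the penalty exact.

  Nondegeneracy and periodic connectivity make the transition matrix over \<open>N * B\<close> steps entrywise at
  least \<open>\<eta> ^ (N * B)\<close>, so the diameter of the agents' states contracts, and square summable
  perturbations give square summable disagreement.

  The Lyapunov function is the sum over the agents of the squared distances of \<open>x\<close> to an optimal
  point and of the multipliers to the fixed large multiplier. The growing multipliers cancel between
  the primal and the dual step, and what remains decreases it by the step size times the exact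
  penalty gap, up to summable errors. So it converges and the gap vanishes along a subsequence, whose
  cluster point is optimal. The multipliers converge by monotonicity, hence so does the distance of
  \<open>x\<close> to that cluster point, and its limit is zero. Finally \<open>y\<close> is a dynamic average consensus on
  the values \<open>f i (x i)\<close>.
\<close>

section \<open>Consensus over balanced networks\<close>

text \<open>Convexity of the square turns the recursion for \<open>V\<close> into one of the same
  shape for its square, with forcing term \<open>(w k)\<^sup>2 / (1 - \<beta>)\<close>. Summing
  bounds each partial sum by \<beta> times itself plus a constant.\<close>

lemma square_summable_if_delayed_contraction:
  fixes V w :: "nat \<Rightarrow> real"
  assumes \<beta>: "0 \<le> \<beta>" "\<beta> < 1" and V0: "\<And>k. 0 \<le> V k" and w0: "\<And>k. 0 \<le> w k"
    and step: "\<And>k. V (k + T) \<le> \<beta> * V k + w k"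
    and w2: "summable (\<lambda>k. (w k)\<^sup>2)"
  shows "summable (\<lambda>k. (V k)\<^sup>2)"
proof -
  have sq: "(V (k + T))\<^sup>2 \<le> \<beta> * (V k)\<^sup>2 + (w k)\<^sup>2 / (1 - \<beta>)" for k
  proof -
    have "(V (k + T))\<^sup>2 \<le> (\<beta> * V k + w k)\<^sup>2"
      using step V0 by (intro power_mono) auto
    \<comment> \<open>Rescaling \<open>w k\<close> exhibits a convex combination with weights
      \<beta> and 1 - \<beta>, so no cross term has to be estimated.\<close>
    also have "\<dots> = (\<beta> * V k + (1 - \<beta>) * (w k / (1 - \<beta>)))\<^sup>2"
      using \<beta> by simp
    also have "\<dots> \<le> \<beta> * (V k)\<^sup>2 + (1 - \<beta>) * (w k / (1 - \<beta>))\<^sup>2"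
      using convex_onD[OF convex_power2, of "1 - \<beta>" "V k" "w k / (1 - \<beta>)"] \<beta> by simp
    also have "(1 - \<beta>) * (w k / (1 - \<beta>))\<^sup>2 = (w k)\<^sup>2 / (1 - \<beta>)"
      using \<beta> by (simp add: power2_eq_square)
    finally show ?thesis .
  qed
  \<comment> \<open>The first \<open>T\<close> terms are those the delayed recursion does not
    reach.\<close>
  define C where "C = (\<Sum>k<T. (V k)\<^sup>2) + (\<Sum>k. (w k)\<^sup>2) / (1 - \<beta>)"
  have "(\<Sum>k<n. (V k)\<^sup>2) \<le> C / (1 - \<beta>)" for n
  proof -
    have "(\<Sum>k<n. (V k)\<^sup>2) \<le> (\<Sum>k<n + T. (V k)\<^sup>2)"
      by (intro sum_mono2) auto
    also have "\<dots> = (\<Sum>k<T. (V k)\<^sup>2) + (\<Sum>k<n. (V (k + T))\<^sup>2)"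
      by (induction n) (auto simp: add.commute)
    also have "(\<Sum>k<n. (V (k + T))\<^sup>2) \<le> (\<Sum>k<n. \<beta> * (V k)\<^sup>2 + (w k)\<^sup>2 / (1 - \<beta>))"
      by (intro sum_mono sq)
    also have "\<dots> = \<beta> * (\<Sum>k<n. (V k)\<^sup>2) + (\<Sum>k<n. (w k)\<^sup>2) / (1 - \<beta>)"
      by (simp add: sum.distrib sum_distrib_left sum_divide_distrib)
    also have "(\<Sum>k<n. (w k)\<^sup>2) / (1 - \<beta>) \<le> (\<Sum>k. (w k)\<^sup>2) / (1 - \<beta>)"
      using \<beta> by (intro divide_right_mono sum_le_suminf w2) auto
    finally have "(1 - \<beta>) * (\<Sum>k<n. (V k)\<^sup>2) \<le> C"
      by (simp add: C_def algebra_simps)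
    then show ?thesis using \<beta> by (simp add: field_simps)
  qed
  then show ?thesis by (intro summableI_nonneg_bounded) auto
qed

text \<open>Coupling argument: with the product weights \<open>p i * q j\<close>, \<open>c\<close>
  times the difference becomes a double sum of the differences \<open>z i - z j\<close>. The mass
  \<open>c\<close> is left general because the contraction below uses rows of a transition matrix
  from which a common part has been removed.\<close>

lemma norm_diff_weighted_sums_le:
  fixes z :: "'i \<Rightarrow> 'v::real_normed_vector"
  assumes "finite I" and p: "\<And>i. i \<in> I \<Longrightarrow> 0 \<le> p i" "sum p I = c"
    and q: "\<And>i. i \<in> I \<Longrightarrow> 0 \<le> q i" "sum q I = c"
    and d: "\<And>i j. i \<in> I \<Longrightarrow> j \<in> I \<Longrightarrow> norm (z i - z j) \<le> d"
  shows "norm ((\<Sum>i\<in>I. p i *\<^sub>R z i) - (\<Sum>i\<in>I. q i *\<^sub>R z i)) \<le> c * d"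
proof (cases "c = 0")
  case True
  then have "p i = 0" "q i = 0" if "i \<in> I" for i
    using that assms sum_nonneg_eq_0_iff[of I p] sum_nonneg_eq_0_iff[of I q] by auto
  then show ?thesis using True by simp
next
  case False
  then have c: "c > 0" using sum_nonneg[of I p] p by fastforce
  have "c *\<^sub>R ((\<Sum>i\<in>I. p i *\<^sub>R z i) - (\<Sum>i\<in>I. q i *\<^sub>R z i))
      = sum q I *\<^sub>R (\<Sum>i\<in>I. p i *\<^sub>R z i) - sum p I *\<^sub>R (\<Sum>i\<in>I. q i *\<^sub>R z i)"
    by (simp add: p q algebra_simps)
  also have "\<dots> = (\<Sum>i\<in>I. \<Sum>j\<in>I. (p i * q j) *\<^sub>R (z i - z j))"
  proof -
    have "(\<Sum>i\<in>I. \<Sum>j\<in>I. (p i * q j) *\<^sub>R z i) = sum q I *\<^sub>R (\<Sum>i\<in>I. p i *\<^sub>R z i)"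
      by (simp add: scaleR_sum_right sum_distrib_left mult.commute flip: scaleR_sum_left)
    moreover have "(\<Sum>i\<in>I. \<Sum>j\<in>I. (p i * q j) *\<^sub>R z j) = sum p I *\<^sub>R (\<Sum>j\<in>I. q j *\<^sub>R z j)"
      by (subst sum.swap)
        (simp add: scaleR_sum_right sum_distrib_right flip: scaleR_sum_left)
    ultimately show ?thesis by (simp add: scaleR_right_diff_distrib sum_subtractf)
  qed
  also have "norm \<dots> \<le> (\<Sum>i\<in>I. \<Sum>j\<in>I. (p i * q j) * d)"
    by (intro sum_norm_le) (auto intro!: mult_left_mono d simp: p q)
  also have "\<dots> = sum p I * sum q I * d"
    by (subst sum_product) (simp only: sum_distrib_right)
  finally show ?thesis using c by (simp add: p q)
qed

lemma norm_weighted_sum_le: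
  fixes z :: "'i \<Rightarrow> 'v::real_normed_vector"
  assumes "\<And>i. i \<in> I \<Longrightarrow> 0 \<le> p i" "sum p I = 1" "\<And>i. i \<in> I \<Longrightarrow> norm (z i) \<le> d"
  shows "norm (\<Sum>i\<in>I. p i *\<^sub>R z i) \<le> d"
proof -
  have "norm (\<Sum>i\<in>I. p i *\<^sub>R z i) \<le> (\<Sum>i\<in>I. p i * d)"
    using assms by (intro sum_norm_le) (auto intro!: mult_left_mono)
  then show ?thesis using assms(2) by (simp flip: sum_distrib_right)
qed

lemma norm_square_weighted_sum_le:
  fixes z :: "'i \<Rightarrow> 'v::real_normed_vector"
  assumes "finite I" and "\<And>i. i \<in> I \<Longrightarrow> 0 \<le> p i" "sum p I = 1"
  shows "(norm ((\<Sum>i\<in>I. p i *\<^sub>R z i) - c))\<^sup>2 \<le> (\<Sum>i\<in>I. p i * (norm (z i - c))\<^sup>2)"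
proof -
  have "(\<Sum>i\<in>I. p i *\<^sub>R z i) - c = (\<Sum>i\<in>I. p i *\<^sub>R (z i - c))"
    using assms(3) by (simp add: scaleR_right_diff_distrib sum_subtractf flip: scaleR_sum_left)
  then have "norm ((\<Sum>i\<in>I. p i *\<^sub>R z i) - c) \<le> (\<Sum>i\<in>I. p i * norm (z i - c))"
    using sum_norm_le[of I "\<lambda>i. p i *\<^sub>R (z i - c)" "\<lambda>i. p i * norm (z i - c)"] assms(2) by auto
  then have "(norm ((\<Sum>i\<in>I. p i *\<^sub>R z i) - c))\<^sup>2 \<le> (\<Sum>i\<in>I. p i * norm (z i - c))\<^sup>2"
    by (intro power_mono) auto
  also have "\<dots> \<le> (\<Sum>i\<in>I. p i * (norm (z i - c))\<^sup>2)"
    using convex_on_sum[OF _ _ convex_power2, of I p "\<lambda>i. norm (z i - c)"] assms by fastforce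
  finally show ?thesis .
qed

section \<open>Doubly stochastic mixing on a periodically connected network\<close>

locale balanced_network =
  fixes N :: nat and a :: "nat \<Rightarrow> nat \<Rightarrow> nat \<Rightarrow> real" and \<eta> :: real and B :: nat
  assumes N_pos: "1 \<le> N"
    and weight_nonneg: "i < N \<Longrightarrow> j < N \<Longrightarrow> 0 \<le> a k i j"
    and \<eta>_pos: "0 < \<eta>"
    and self_weight: "i < N \<Longrightarrow> \<eta> \<le> a k i i"
    and edge_weight: "i < N \<Longrightarrow> j < N \<Longrightarrow> 0 < a k i j \<Longrightarrow> \<eta> \<le> a k i j"
    and row_sum: "i < N \<Longrightarrow> (\<Sum>j<N. a k i j) = 1"
    and col_sum: "j < N \<Longrightarrow> (\<Sum>i<N. a k i j) = 1"
    and connected: "strongly_connected_on N (\<Union>k<B. comm_edges N a (k0 + k))"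
begin

lemma sum_mix:
  fixes z :: "nat \<Rightarrow> 'v::real_vector"
  shows "(\<Sum>i<N. \<Sum>j<N. a k i j *\<^sub>R z j) = (\<Sum>j<N. z j)"
proof -
  have "(\<Sum>i<N. \<Sum>j<N. a k i j *\<^sub>R z j) = (\<Sum>j<N. (\<Sum>i<N. a k i j) *\<^sub>R z j)"
    by (subst sum.swap) (simp add: scaleR_sum_left)
  then show ?thesis by (simp add: col_sum)
qed

text \<open>Jensen's inequality along the rows, then the unit column sums. This is why mixing never
  increases the Lyapunov function.\<close>

lemma sum_norm_square_mix_le:
  fixes z :: "nat \<Rightarrow> 'v::real_normed_vector"
  shows "(\<Sum>i<N. (norm ((\<Sum>j<N. a k i j *\<^sub>R z j) - c))\<^sup>2) \<le> (\<Sum>i<N. (norm (z i - c))\<^sup>2)"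
proof -
  have "(\<Sum>i<N. (norm ((\<Sum>j<N. a k i j *\<^sub>R z j) - c))\<^sup>2)
      \<le> (\<Sum>i<N. \<Sum>j<N. a k i j *\<^sub>R (norm (z j - c))\<^sup>2)"
    unfolding real_scaleR_def
    by (intro sum_mono norm_square_weighted_sum_le) (auto simp: weight_nonneg row_sum)
  then show ?thesis unfolding sum_mix .
qed

section \<open>Products of the weight matrices and a lower bound for their entries\<close>

primrec transition :: "nat \<Rightarrow> nat \<Rightarrow> nat \<Rightarrow> nat \<Rightarrow> real" where
  "transition k0 0 = (\<lambda>i j. if i = j then 1 else 0)"
| "transition k0 (Suc t) = (\<lambda>i j. \<Sum>l<N. a (k0 + t) i l * transition k0 t l j)"

lemma transition_nonneg: "i < N \<Longrightarrow> j < N \<Longrightarrow> 0 \<le> transition k0 t i j"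
  by (induction t arbitrary: i) (auto intro!: sum_nonneg mult_nonneg_nonneg weight_nonneg)

lemma transition_row_sum: "i < N \<Longrightarrow> (\<Sum>j<N. transition k0 t i j) = 1"
proof (induction t arbitrary: i)
  case (Suc t)
  have "(\<Sum>j<N. transition k0 (Suc t) i j) = (\<Sum>l<N. a (k0 + t) i l * (\<Sum>j<N. transition k0 t l j))"
    by (simp add: sum_distrib_left) (rule sum.swap)
  then show ?case using Suc by (simp add: row_sum)
qed auto

text \<open>The route through \<open>l\<close> is one nonnegative term of the matrix product; each
  further step costs one factor \<open>\<eta>\<close>.\<close>

lemma transition_Suc_ge:
  assumes "i < N" "j < N" "l < N" "\<eta> \<le> a (k0 + t) i l" "\<eta> ^ t \<le> transition k0 t l j"
  shows "\<eta> ^ Suc t \<le> transition k0 (Suc t) i j"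
proof -
  have "\<eta> ^ Suc t \<le> a (k0 + t) i l * transition k0 t l j"
    using assms \<eta>_pos by (auto intro!: mult_mono simp: weight_nonneg)
  also have "\<dots> \<le> transition k0 (Suc t) i j"
    using assms by (auto intro!: member_le_sum mult_nonneg_nonneg weight_nonneg transition_nonneg)
  finally show ?thesis .
qed

text \<open>The threshold loses one factor \<open>\<eta>\<close> per step, so that the self weight
  alone keeps an agent in the set.\<close>

definition reached :: "nat \<Rightarrow> nat \<Rightarrow> nat \<Rightarrow> nat set" where
  "reached k0 j t = {i. i < N \<and> \<eta> ^ t \<le> transition k0 t i j}"

lemma reached_mono:
  assumes "j < N" "t \<le> u" shows "reached k0 j t \<subseteq> reached k0 j u"
  using assms(2)
proof (induction u rule: dec_induct)
  case (step u)
  have "reached k0 j u \<subseteq> reached k0 j (Suc u)"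
    using transition_Suc_ge[OF _ assms(1), of _ _ k0 u] self_weight
    by (auto simp: reached_def simp del: transition.simps)
  with step show ?case by blast
qed auto

text \<open>Connectivity over one window yields an edge leaving the set. Whenever in the window it
  is active, its tail is still in the set by monotonicity, so its head enters at the next step and
  remains until the window ends.\<close>

lemma reached_grows:
  assumes j: "j < N" and ne: "reached k0 j t \<noteq> {..<N}"
  shows "reached k0 j t \<subset> reached k0 j (t + B)"
proof -
  let ?R = "reached k0 j t"
  have sub: "?R \<subseteq> {..<N}" by (auto simp: reached_def)
  have "j \<in> reached k0 j 0" using j by (auto simp: reached_def)
  then have jR: "j \<in> ?R" using reached_mono[OF j, of 0 t] by auto
  obtain i where i: "i < N" "i \<notin> ?R" using ne sub by auto
  let ?E = "\<Union>u<B. comm_edges N a ((k0 + t) + u)"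
  have "(j, i) \<in> ?E\<^sup>*"
    using connected[of "k0 + t"] i j unfolding strongly_connected_on_def by blast
  \<comment> \<open>A path from \<open>j\<close> either ends inside the set or has an edge that
    crosses out of it.\<close>
  then have "i \<in> ?R \<or> (\<exists>p q. (p, q) \<in> ?E \<and> p \<in> ?R \<and> q \<notin> ?R)"
    by (induction rule: rtrancl_induct) (use jR in blast)+
  then obtain p q u where u: "u < B" and pq: "p \<in> ?R" "q \<notin> ?R"
    and e: "(p, q) \<in> comm_edges N a (k0 + t + u)" using i by blast
  have "p \<in> reached k0 j (t + u)" using pq reached_mono[OF j, of t "t + u"] by auto
  then have "q \<in> reached k0 j (Suc (t + u))"
    using e transition_Suc_ge[of q j p k0 "t + u"] j edge_weight[of q p]
    by (auto simp: reached_def comm_edges_def add.assoc simp del: transition.simps)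
  then have "q \<in> reached k0 j (t + B)"
    using reached_mono[OF j, of "Suc (t + u)" "t + B"] u by auto
  with pq reached_mono[OF j, of t "t + B"] show ?thesis by auto
qed

text \<open>The set reached from \<open>j\<close> gains at least one agent per window until it
  contains all of them, so \<open>N\<close> windows suffice.\<close>

lemma transition_ge:
  assumes "i < N" "j < N" shows "\<eta> ^ (N * B) \<le> transition k0 (N * B) i j"
proof -
  have "reached k0 j (n * B) = {..<N} \<or> n \<le> card (reached k0 j (n * B))" for n
  proof (induction n)
    case (Suc n)
    have fin: "finite (reached k0 j t)" for t by (auto simp: reached_def)
    show ?case
    proof (cases "reached k0 j (n * B) = {..<N}")
      case True
      then have "{..<N} \<subseteq> reached k0 j (Suc n * B)"
        using reached_mono[OF assms(2), of "n * B" "Suc n * B"] by auto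
      then show ?thesis by (auto simp: reached_def)
    next
      case False
      have "card (reached k0 j (n * B)) < card (reached k0 j (Suc n * B))"
        using psubset_card_mono[OF fin reached_grows[OF assms(2) False]] by (simp add: add.commute)
      with Suc False show ?thesis by linarith
    qed
  qed auto
  moreover have "reached k0 j (N * B) \<subseteq> {..<N}" by (auto simp: reached_def)
  ultimately have "reached k0 j (N * B) = {..<N}"
    using card_seteq[of "{..<N}"] by (metis card_lessThan finite_lessThan)
  with assms show ?thesis by (auto simp: reached_def)
qed

text \<open>Averages with row-stochastic weights do not amplify earlier errors, so the errors merely
  add up.\<close>

lemma perturbed_mix_unfold:
  fixes z :: "nat \<Rightarrow> nat \<Rightarrow> 'v::real_normed_vector"
  assumes pert: "\<And>i k. i < N \<Longrightarrow> norm (z i (Suc k) - (\<Sum>j<N. a k i j *\<^sub>R z j k)) \<le> \<epsilon> k"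
    and "i < N"
  shows "norm (z i (k0 + t) - (\<Sum>j<N. transition k0 t i j *\<^sub>R z j k0)) \<le> (\<Sum>u<t. \<epsilon> (k0 + u))"
  using assms(2)
proof (induction t arbitrary: i)
  case 0
  have "(\<Sum>j<N. transition k0 0 i j *\<^sub>R z j k0) = (\<Sum>j<N. if j = i then z j k0 else 0)"
    by (intro sum.cong) auto
  also have "\<dots> = z i k0" using 0 by simp
  finally show ?case by simp
next
  case (Suc t)
  let ?P = "\<lambda>l. \<Sum>j<N. transition k0 t l j *\<^sub>R z j k0"
  have "(\<Sum>j<N. transition k0 (Suc t) i j *\<^sub>R z j k0) = (\<Sum>l<N. a (k0 + t) i l *\<^sub>R ?P l)"
    by (simp add: scaleR_sum_right scaleR_sum_left) (rule sum.swap)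
  then have eq: "z i (k0 + Suc t) - (\<Sum>j<N. transition k0 (Suc t) i j *\<^sub>R z j k0)
     = (\<Sum>l<N. a (k0 + t) i l *\<^sub>R (z l (k0 + t) - ?P l))
       + (z i (Suc (k0 + t)) - (\<Sum>l<N. a (k0 + t) i l *\<^sub>R z l (k0 + t)))"
    by (simp add: scaleR_right_diff_distrib sum_subtractf del: transition.simps)
  show ?case unfolding eq sum.lessThan_Suc
  proof (intro norm_triangle_mono pert norm_weighted_sum_le)
    show "norm (z l (k0 + t) - ?P l) \<le> (\<Sum>u<t. \<epsilon> (k0 + u))" if "l \<in> {..<N}" for l
      using Suc.IH that by simp
  qed (use Suc.prems in \<open>auto simp: weight_nonneg row_sum\<close>)
qed

section \<open>Contraction of the disagreement\<close>

definition disagreement :: "(nat \<Rightarrow> nat \<Rightarrow> 'v::real_normed_vector) \<Rightarrow> nat \<Rightarrow> real" where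
  "disagreement z k = diameter ((\<lambda>i. z i k) ` {..<N})"

lemma norm_diff_le_disagreement:
  "i < N \<Longrightarrow> j < N \<Longrightarrow> norm (z i k - z j k) \<le> disagreement z k"
  unfolding disagreement_def dist_norm[symmetric]
  by (intro diameter_bounded_bound) (auto intro: finite_imp_bounded)

lemma disagreement_nonneg: "0 \<le> disagreement z k"
  using norm_diff_le_disagreement[of 0 0 z k] N_pos by auto

lemma mix_near:
  assumes "i < N" "j < N"
  shows "norm ((\<Sum>l<N. a k i l *\<^sub>R z l k) - z j k) \<le> disagreement z k"
proof -
  have "(\<Sum>l<N. a k i l *\<^sub>R z l k) - z j k = (\<Sum>l<N. a k i l *\<^sub>R (z l k - z j k))"
    using assms by (simp add: scaleR_right_diff_distrib sum_subtractf row_sum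
        flip: scaleR_sum_left)
  also have "norm \<dots> \<le> disagreement z k"
    using assms by (intro norm_weighted_sum_le norm_diff_le_disagreement)
      (auto simp: weight_nonneg row_sum)
  finally show ?thesis .
qed

text \<open>Over \<open>N * B\<close> steps all rows of the transition matrix share the part
  \<open>\<eta> ^ (N * B)\<close> in each entry. It cancels in differences, leaving mass
  \<open>1 - N * \<eta> ^ (N * B)\<close> to separate two agents; the factor 2 counts the
  accumulated perturbations of both.\<close>

lemma disagreement_contracts:
  fixes z :: "nat \<Rightarrow> nat \<Rightarrow> 'v::real_normed_vector"
  assumes pert: "\<And>i k. i < N \<Longrightarrow> norm (z i (Suc k) - (\<Sum>j<N. a k i j *\<^sub>R z j k)) \<le> \<epsilon> k"
  shows "disagreement z (k + N * B)
    \<le> (1 - N * \<eta> ^ (N * B)) * disagreement z k + 2 * (\<Sum>u<N * B. \<epsilon> (k + u))"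
proof -
  let ?T = "N * B" and ?\<delta> = "\<eta> ^ (N * B)"
  let ?A = "\<lambda>i. \<Sum>j<N. transition k ?T i j *\<^sub>R z j k"
  have "norm (z i (k + ?T) - z j (k + ?T))
      \<le> (1 - N * ?\<delta>) * disagreement z k + 2 * (\<Sum>u<?T. \<epsilon> (k + u))"
    if ij: "i < N" "j < N" for i j
  proof -
    have split: "?A i = (\<Sum>l<N. (transition k ?T i l - ?\<delta>) *\<^sub>R z l k) + (\<Sum>l<N. ?\<delta> *\<^sub>R z l k)" for i
      by (simp add: scaleR_left_diff_distrib sum_subtractf)
    have "norm (?A i - ?A j) \<le> (1 - N * ?\<delta>) * disagreement z k"
      unfolding split add_diff_cancel_right
      using ij by (intro norm_diff_weighted_sums_le norm_diff_le_disagreement)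
        (auto simp: transition_ge sum_subtractf transition_row_sum)
    moreover have "norm (z i (k + ?T) - ?A i) \<le> (\<Sum>u<?T. \<epsilon> (k + u))"
      "norm (z j (k + ?T) - ?A j) \<le> (\<Sum>u<?T. \<epsilon> (k + u))"
      using perturbed_mix_unfold[where z=z and \<epsilon>=\<epsilon>] pert ij by auto
    moreover have "norm (z i (k + ?T) - z j (k + ?T))
      \<le> norm (?A i - ?A j) + norm (z i (k + ?T) - ?A i) + norm (z j (k + ?T) - ?A j)"
      by norm
    ultimately show ?thesis by linarith
  qed
  then show ?thesis
    unfolding disagreement_def[of z "k + ?T"] using N_pos
    by (intro diameter_le) (auto simp: lessThan_empty_iff)
qed

lemma disagreement_square_summable:
  fixes z :: "nat \<Rightarrow> nat \<Rightarrow> 'v::real_normed_vector"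
  assumes pert: "\<And>i k. i < N \<Longrightarrow> norm (z i (Suc k) - (\<Sum>j<N. a k i j *\<^sub>R z j k)) \<le> \<epsilon> k"
    and \<epsilon>: "summable (\<lambda>k. (\<epsilon> k)\<^sup>2)"
  shows "summable (\<lambda>k. (disagreement z k)\<^sup>2)"
proof (rule square_summable_if_delayed_contraction)
  let ?w = "\<lambda>k. 2 * (\<Sum>u<N * B. \<epsilon> (k + u))"
  have \<epsilon>0: "0 \<le> \<epsilon> k" for k using order.trans[OF norm_ge_zero pert[of 0 k]] N_pos by simp
  show "disagreement z (k + N * B) \<le> (1 - N * \<eta> ^ (N * B)) * disagreement z k + ?w k" for k
    using disagreement_contracts[where \<epsilon>=\<epsilon>] pert by blast
  \<comment> \<open>A row of the transition matrix sums to one and has entries at least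
    \<open>\<eta> ^ (N * B)\<close>, so the contraction factor is nonnegative.\<close>
  have "N * \<eta> ^ (N * B) \<le> (\<Sum>j<N. transition 0 (N * B) 0 j)"
    using sum_mono[of "{..<N}" "\<lambda>_. \<eta> ^ (N * B)" "transition 0 (N * B) 0"] N_pos
    by (auto simp: transition_ge)
  then show "0 \<le> 1 - N * \<eta> ^ (N * B)" using N_pos by (simp add: transition_row_sum)
  show "1 - N * \<eta> ^ (N * B) < 1" using N_pos \<eta>_pos by simp
  show "0 \<le> disagreement z k" for k by (rule disagreement_nonneg)
  show "0 \<le> ?w k" for k using \<epsilon>0 by (auto intro!: sum_nonneg)
  show "summable (\<lambda>k. (?w k)\<^sup>2)"
  proof (rule summable_comparison_test')
    \<comment> \<open>Cauchy-Schwarz over the perturbations of one window.\<close>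
    show "norm ((?w k)\<^sup>2) \<le> 4 * ((\<Sum>u<N * B. (\<epsilon> (k + u))\<^sup>2) * real (N * B))" if "0 \<le> k" for k
      using sum_squared_le_sum_of_squares[of "\<lambda>u. \<epsilon> (k + u)" "{..<N * B}"]
      by (simp add: power_mult_distrib)
    show "summable (\<lambda>k. 4 * ((\<Sum>u<N * B. (\<epsilon> (k + u))\<^sup>2) * real (N * B)))"
      using \<epsilon> by (intro summable_mult summable_mult2 summable_sum)
        (simp add: summable_iff_shift[of "\<lambda>k. (\<epsilon> k)\<^sup>2"])
  qed
qed

lemma disagreement_tendsto_zero:
  assumes "summable (\<lambda>k. (disagreement z k)\<^sup>2)" shows "disagreement z \<longlonglongrightarrow> 0"
  using tendsto_real_sqrt[OF summable_LIMSEQ_zero[OF assms]] by (simp add: disagreement_nonneg)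

text \<open>\<open>z i\<close> is the network mean plus the mean of its vanishing differences to all
  agents.\<close>

lemma tendsto_mean_if_disagreement_tendsto_zero:
  fixes z :: "nat \<Rightarrow> nat \<Rightarrow> real"
  assumes "disagreement z \<longlonglongrightarrow> 0" and "(\<lambda>k. \<Sum>j<N. z j k) \<longlonglongrightarrow> L" and i: "i < N"
  shows "z i \<longlonglongrightarrow> L / N"
proof -
  have "(\<lambda>k. z i k - z j k) \<longlonglongrightarrow> 0" if "j < N" for j
    using norm_diff_le_disagreement[OF i that, of z] by (intro Lim_null_comparison[OF _ assms(1)]) auto
  then have "(\<lambda>k. (\<Sum>j<N. z i k - z j k) / N + (\<Sum>j<N. z j k) / N) \<longlonglongrightarrow> (\<Sum>j<N. 0) / N + L / N"
    using N_pos by (intro tendsto_intros assms) auto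
  then show ?thesis using N_pos by (simp add: sum_subtractf diff_divide_distrib)
qed

end

section \<open>Exactness of the penalty\<close>

text \<open>The Minkowski sum of \<open>X\<close> and the unit ball is compact, and a finite convex
  function is continuous. The next two bounds exploit this unit margin around
  \<open>X\<close>.\<close>

lemma convex_on_UNIV_bounded_near:
  fixes F :: "'a::euclidean_space \<Rightarrow> real"
  assumes "convex_on UNIV F" "compact X"
  obtains C where "0 \<le> C" "\<And>z u. z \<in> X \<Longrightarrow> norm u \<le> 1 \<Longrightarrow> \<bar>F (z + u)\<bar> \<le> C"
proof -
  have "compact {z + u |z u. z \<in> X \<and> u \<in> cball 0 1}"
    by (intro compact_sums assms(2) compact_cball)
  moreover have "continuous_on {z + u |z u. z \<in> X \<and> u \<in> cball 0 1} F"
    using convex_on_continuous[OF open_UNIV assms(1)] continuous_on_subset by blast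
  ultimately have "bounded (F ` {z + u |z u. z \<in> X \<and> u \<in> cball 0 1})"
    by (intro compact_imp_bounded compact_continuous_image)
  then obtain C where "0 < C" "\<forall>y\<in>F ` {z + u |z u. z \<in> X \<and> u \<in> cball 0 1}. norm y \<le> C"
    unfolding bounded_pos by blast
  then show thesis by (intro that[of C]) (auto simp: image_iff)
qed

text \<open>Testing the subgradient inequality one unit along \<open>d\<close> bounds
  \<open>norm d\<close> by the oscillation of \<open>F\<close> in the unit margin.\<close>

lemma subgradients_bounded:
  fixes F :: "'a::euclidean_space \<Rightarrow> real"
  assumes "convex_on UNIV F" "compact X"
  obtains C where "0 \<le> C" "\<And>z d. z \<in> X \<Longrightarrow> is_subgradient F z d \<Longrightarrow> norm d \<le> C"
proof -
  obtain C where C: "0 \<le> C" "\<And>z u. z \<in> X \<Longrightarrow> norm u \<le> 1 \<Longrightarrow> \<bar>F (z + u)\<bar> \<le> C"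
    using convex_on_UNIV_bounded_near[OF assms] by blast
  have "norm d \<le> 2 * C" if z: "z \<in> X" and d: "is_subgradient F z d" for z d
  proof (cases "d = 0")
    case False
    have "F (z + sgn d) \<ge> F z + inner d (sgn d)"
      using d unfolding is_subgradient_def by (metis add_diff_cancel_left')
    moreover have "inner d (sgn d) = norm d"
      using False by (simp add: sgn_div_norm power2_norm_eq_inner[symmetric] power2_eq_square)
    moreover have "\<bar>F (z + sgn d)\<bar> \<le> C" "\<bar>F z\<bar> \<le> C"
      using C(2)[OF z, of "sgn d"] C(2)[OF z, of 0] by (auto simp: norm_sgn)
    ultimately show ?thesis by simp
  qed (use C in auto)
  then show thesis using C(1) by (intro that[of "2 * C"]) auto
qed

text \<open>Prolonging the segment from \<open>z\<close> to \<open>w\<close> by one unit stays where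
  \<open>F\<close> is bounded, and convexity along it bounds the slope between \<open>z\<close> and
  \<open>w\<close>.\<close>

lemma convex_on_UNIV_lipschitz:
  fixes F :: "'a::euclidean_space \<Rightarrow> real"
  assumes F: "convex_on UNIV F" and "compact X"
  obtains L where "0 \<le> L" "\<And>z w. z \<in> X \<Longrightarrow> w \<in> X \<Longrightarrow> \<bar>F z - F w\<bar> \<le> L * norm (z - w)"
proof -
  obtain C where C: "0 \<le> C" "\<And>z u. z \<in> X \<Longrightarrow> norm u \<le> 1 \<Longrightarrow> \<bar>F (z + u)\<bar> \<le> C"
    using convex_on_UNIV_bounded_near[OF assms] by blast
  have one: "F w - F z \<le> 2 * C * norm (z - w)" if zw: "z \<in> X" "w \<in> X" for z w
  proof (cases "z = w")
    case False
    define t where "t = norm (w - z)"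
    have t: "t > 0" using False by (simp add: t_def)
    \<comment> \<open>\<open>u\<close> lies one unit beyond \<open>w\<close> as seen from
      \<open>z\<close>, so \<open>w\<close> divides the segment in the ratio \<open>t\<close> to
      1.\<close>
    define u where "u = w + sgn (w - z)"
    have "t *\<^sub>R (u - w) = w - z"
      using t by (simp add: u_def sgn_div_norm t_def)
    then have "(1 + t) *\<^sub>R w = z + t *\<^sub>R u" by (simp add: algebra_simps)
    then have "inverse (1 + t) *\<^sub>R (z + t *\<^sub>R u) = inverse (1 + t) *\<^sub>R ((1 + t) *\<^sub>R w)" by simp
    also have "\<dots> = w" using t by (simp only: scaleR_scaleR) simp
    finally have "w = inverse (1 + t) *\<^sub>R z + (t / (1 + t)) *\<^sub>R u"
      by (simp add: scaleR_right_distrib divide_inverse mult.commute)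
    moreover have "inverse (1 + t) = 1 - t / (1 + t)" using t by (simp add: field_simps)
    ultimately have w: "w = (1 - t / (1 + t)) *\<^sub>R z + (t / (1 + t)) *\<^sub>R u"
      by (simp only:)
    have "F w \<le> (1 - t / (1 + t)) * F z + (t / (1 + t)) * F u"
      using convex_onD[OF F, of "t / (1 + t)" z u] t w by simp
    then have "F w - F z \<le> t / (1 + t) * (F u - F z)"
      by (simp add: left_diff_distrib right_diff_distrib)
    also have "\<dots> \<le> t / (1 + t) * (2 * C)"
      using C(2)[of z 0] C(2)[of w "sgn (w - z)"] zw t False
      by (intro mult_left_mono) (auto simp: u_def norm_sgn)
    also have "\<dots> \<le> t * (2 * C)"
      using t C divide_left_mono[of 1 "1 + t" t] by (intro mult_right_mono) auto
    finally show ?thesis by (simp add: t_def norm_minus_commute mult.commute)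
  qed auto
  have "\<bar>F z - F w\<bar> \<le> 2 * C * norm (z - w)" if "z \<in> X" "w \<in> X" for z w
    using one[OF that] one[OF that(2,1)] by (simp add: norm_minus_commute)
  then show thesis using C(1) by (intro that[of "2 * C"]) auto
qed

section \<open>Convex violation functions and error bounds\<close>

lemma convex_on_pos_part:
  assumes "convex_on A g" shows "convex_on A (\<lambda>z. max 0 (g z))"
proof (intro convex_onI)
  fix t x y assume t: "0 < t" "t < (1::real)" and xy: "x \<in> A" "y \<in> A"
  have "g ((1 - t) *\<^sub>R x + t *\<^sub>R y) \<le> (1 - t) * g x + t * g y"
    using convex_onD[OF assms, of t x y] t xy by simp
  also have "\<dots> \<le> (1 - t) * max 0 (g x) + t * max 0 (g y)"
    using t by (intro add_mono mult_left_mono) auto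
  finally show "max 0 (g ((1 - t) *\<^sub>R x + t *\<^sub>R y)) \<le> (1 - t) * max 0 (g x) + t * max 0 (g y)"
    using t by auto
qed (use assms convex_on_imp_convex in blast)

lemma convex_on_abs_affine: "convex_on UNIV (\<lambda>z. \<bar>inner v z - b\<bar> :: real)"
proof (intro convex_onI)
  fix t x y assume t: "0 < t" "t < (1::real)"
  have "inner v ((1 - t) *\<^sub>R x + t *\<^sub>R y) - b = (1 - t) * (inner v x - b) + t * (inner v y - b)"
    by (simp add: inner_add_right algebra_simps)
  then show "\<bar>inner v ((1 - t) *\<^sub>R x + t *\<^sub>R y) - b\<bar> \<le> (1 - t) * \<bar>inner v x - b\<bar> + t * \<bar>inner v y - b\<bar>"
    using t abs_triangle_ineq[of "(1 - t) * (inner v x - b)" "t * (inner v y - b)"]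
    by (simp add: abs_mult)
qed auto

text \<open>On the unit vectors of \<open>V\<close> orthogonal to the kernel the residual is
  continuous and positive, hence bounded below by compactness. The component of \<open>v\<close>
  orthogonal to the kernel is therefore a small solution with the same residual.\<close>

lemma linear_system_error_bound:
  fixes V :: "'a::euclidean_space set" and A :: "nat \<Rightarrow> 'a"
  assumes V: "subspace V"
  obtains C where "0 \<le> C"
    "\<And>v. v \<in> V \<Longrightarrow> \<exists>w\<in>V. (\<forall>l<\<nu>. inner (A l) w = inner (A l) v) \<and> norm w \<le> C * (\<Sum>l<\<nu>. \<bar>inner (A l) v\<bar>)"
proof -
  define K where "K = {w \<in> V. \<forall>l<\<nu>. inner (A l) w = 0}"
  have K: "subspace K"
    using V by (auto simp: K_def subspace_def inner_add_right)
  define Z where "Z = {z \<in> V. \<forall>k\<in>K. inner z k = 0} \<inter> sphere 0 1"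
  define \<phi> where "\<phi> z = (\<Sum>l<\<nu>. \<bar>inner (A l) z\<bar>)" for z
  have "{z \<in> V. \<forall>k\<in>K. inner z k = 0} = V \<inter> (\<Inter>k\<in>K. {z. inner z k = 0})" by auto
  moreover have "closed (V \<inter> (\<Inter>k\<in>K. {z. inner z k = 0}))"
    using closed_subspace[OF V] by (intro closed_Int closed_INT ballI) (auto intro!: closed_Collect_eq continuous_intros)
  ultimately have Z: "compact Z" unfolding Z_def by (intro closed_Int_compact) auto
  have \<phi>Z: "\<phi> z > 0" if "z \<in> Z" for z
  proof (rule ccontr)
    assume "\<not> \<phi> z > 0"
    then have "\<phi> z = 0" unfolding \<phi>_def by (meson abs_ge_zero sum_nonneg linorder_not_le order.antisym)
    then have "z \<in> K" using that by (auto simp: \<phi>_def sum_nonneg_eq_0_iff K_def Z_def)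
    then have "inner z z = 0" using that by (auto simp: Z_def)
    then show False using that by (auto simp: Z_def)
  qed
  have cont: "continuous_on Z \<phi>" unfolding \<phi>_def by (intro continuous_intros)
  \<comment> \<open>If the kernel is all of \<open>V\<close>, there are no such unit vectors and any
    positive constant will do.\<close>
  obtain c where c: "c > 0" "\<And>z. z \<in> Z \<Longrightarrow> c \<le> \<phi> z"
  proof (cases "Z = {}")
    case False
    then obtain z where "z \<in> Z" "\<forall>y\<in>Z. \<phi> z \<le> \<phi> y"
      using continuous_attains_inf[OF Z _ cont] by blast
    then show thesis using \<phi>Z that by blast
  qed (use that[of 1] in auto)
  show thesis
  proof (rule that[of "1 / c"])
    fix v assume v: "v \<in> V"
    obtain y z where y: "y \<in> span K" and z: "\<And>w. w \<in> span K \<Longrightarrow> orthogonal z w" and vyz: "v = y + z"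
      using orthogonal_subspace_decomp_exists[of K v] by blast
    have yK: "y \<in> K" using y K by (simp add: span_eq_iff[THEN iffD2])
    then have zV: "z \<in> V"
      using v vyz subspace_diff[OF V v, of y] by (auto simp: K_def)
    have eq: "\<forall>l<\<nu>. inner (A l) z = inner (A l) v"
      using yK vyz by (auto simp: K_def inner_add_right)
    have "c * norm z \<le> \<phi> z"
    proof (cases "z = 0")
      case False
      have "sgn z \<in> Z"
        using zV z False V by (auto simp: Z_def sgn_div_norm subspace_scale orthogonal_def span_base)
      then have "c \<le> \<phi> (sgn z)" by (rule c)
      also have "\<dots> = \<phi> z / norm z"
        by (simp add: \<phi>_def sgn_div_norm sum_distrib_left abs_mult divide_inverse mult.commute)
      finally show ?thesis using False by (simp add: field_simps)
    qed (simp add: \<phi>_def)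
    moreover have "\<phi> z = (\<Sum>l<\<nu>. \<bar>inner (A l) v\<bar>)" using eq by (simp add: \<phi>_def)
    ultimately show "\<exists>w\<in>V. (\<forall>l<\<nu>. inner (A l) w = inner (A l) v)
        \<and> norm w \<le> 1 / c * (\<Sum>l<\<nu>. \<bar>inner (A l) v\<bar>)"
      using zV eq c(1) by (intro bexI[of _ z]) (auto simp: field_simps)
  qed (use c in simp)
qed

text \<open>The linear bound, applied to the directions of the affine hull, gives a correction
  \<open>w\<close> proportional to the residual. A ball of the hull around \<open>xt\<close> lies in
  \<open>X\<close>, so the corrected point returns to \<open>X\<close> at a cost proportional to
  \<open>norm w\<close>, and moving towards \<open>xt\<close> keeps the equations solved.\<close>

lemma affine_error_bound:
  fixes X :: "'a::euclidean_space set" and A :: "nat \<Rightarrow> 'a"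
  assumes X: "compact X" "convex X" and xt: "xt \<in> rel_interior X" "\<forall>l<\<nu>. inner (A l) xt = b l"
  shows "\<exists>C\<ge>0. \<forall>x\<in>X. \<exists>x'\<in>X. (\<forall>l<\<nu>. inner (A l) x' = b l)
    \<and> norm (x - x') \<le> C * (\<Sum>l<\<nu>. \<bar>inner (A l) x - b l\<bar>)"
proof -
  obtain r where xtX: "xt \<in> X" and r: "r > 0" "cball xt r \<inter> affine hull X \<subseteq> X"
    using xt(1) unfolding mem_rel_interior_cball by blast
  define V where "V = (\<lambda>x. x - xt) ` (affine hull X)"
  have xth: "xt \<in> affine hull X" using xtX by (rule hull_inc)
  have V: "subspace V"
    unfolding V_def by (rule affine_diffs_subspace_subtract) (use xth in auto)
  have Vin: "xt + v \<in> affine hull X" if "v \<in> V" for v using that by (auto simp: V_def)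
  obtain C where C: "0 \<le> C" "\<And>v. v \<in> V \<Longrightarrow> \<exists>w\<in>V. (\<forall>l<\<nu>. inner (A l) w = inner (A l) v)
      \<and> norm w \<le> C * (\<Sum>l<\<nu>. \<bar>inner (A l) v\<bar>)"
    using linear_system_error_bound[OF V] by blast
  have bX: "bounded X" using X compact_imp_bounded by blast
  show ?thesis
  proof (intro exI[of _ "(1 + diameter X / r) * C"] conjI ballI)
    show "0 \<le> (1 + diameter X / r) * C"
      using C(1) r diameter_ge_0[OF bX] by auto
    fix x assume x: "x \<in> X"
    have xV: "x - xt \<in> V" using x by (auto simp: V_def hull_inc)
    then obtain w where w: "w \<in> V" "\<forall>l<\<nu>. inner (A l) w = inner (A l) (x - xt)"
      "norm w \<le> C * (\<Sum>l<\<nu>. \<bar>inner (A l) (x - xt)\<bar>)" using C(2) by blast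
    let ?e = "\<Sum>l<\<nu>. \<bar>inner (A l) x - b l\<bar>"
    have wb: "norm w \<le> C * ?e" using w(3) xt(2) by (simp add: inner_diff_right)
    \<comment> \<open>This weight gives \<open>(1 - \<theta>) * norm w = \<theta> * r\<close>: the
      remaining share of \<open>w\<close> is absorbed by shifting \<open>xt\<close> within its ball
      of radius \<open>r\<close>.\<close>
    define \<theta> where "\<theta> = norm w / (r + norm w)"
    have \<theta>: "0 \<le> \<theta>" "\<theta> \<le> 1"
      using r by (auto simp: \<theta>_def divide_le_eq add_pos_nonneg)
    have \<theta>r: "\<theta> \<le> norm w / r"
      unfolding \<theta>_def using r by (intro divide_left_mono) (auto simp: add_pos_nonneg)
    \<comment> \<open>The point x - w solves the system but may leave X; moving it towards the relative interior
      point brings it back.\<close>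
    define x' where "x' = (1 - \<theta>) *\<^sub>R (x - w) + \<theta> *\<^sub>R xt"
    have eq: "inner (A l) x' = b l" if "l < \<nu>" for l
    proof -
      have "inner (A l) (x - w) = b l"
        using w(2) xt(2) that that by (simp add: inner_diff_right)
      then show ?thesis
        using xt(2) that by (simp add: x'_def inner_add_right algebra_simps)
    qed
    have "x' \<in> X"
    proof (cases "w = 0")
      case True
      then show ?thesis using x by (simp add: x'_def \<theta>_def)
    next
      case False
      have "- (r *\<^sub>R sgn w) \<in> V"
        using w(1) V by (simp add: sgn_div_norm subspace_scale subspace_neg)
      then have "xt - r *\<^sub>R sgn w \<in> affine hull X" using Vin by fastforce
      moreover have "xt - r *\<^sub>R sgn w \<in> cball xt r" using r by (simp add: dist_norm norm_sgn)
      ultimately have inX: "xt - r *\<^sub>R sgn w \<in> X" using r by blast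
      have "1 - \<theta> = r / (r + norm w)"
        using r add_pos_nonneg[OF r(1) norm_ge_zero[of w]] by (simp add: \<theta>_def field_simps)
      then have "(1 - \<theta>) *\<^sub>R w = (\<theta> * r) *\<^sub>R sgn w"
        using False by (simp add: \<theta>_def sgn_div_norm)
      then have "x' = (1 - \<theta>) *\<^sub>R x + \<theta> *\<^sub>R (xt - r *\<^sub>R sgn w)"
        by (simp add: x'_def scaleR_right_diff_distrib)
      then show ?thesis using X(2) x inX \<theta> by (auto intro: convexD_alt)
    qed
    moreover have "norm (x - x') \<le> (1 + diameter X / r) * C * ?e"
    proof -
      have "x - x' = (1 - \<theta>) *\<^sub>R w + \<theta> *\<^sub>R (x - xt)"
        by (simp add: x'_def algebra_simps)
      also have "norm \<dots> \<le> (1 - \<theta>) * norm w + \<theta> * norm (x - xt)"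
        using \<theta> norm_triangle_ineq[of "(1 - \<theta>) *\<^sub>R w" "\<theta> *\<^sub>R (x - xt)"] by simp
      also have "\<dots> \<le> 1 * norm w + norm w / r * diameter X"
        using \<theta> \<theta>r r diameter_bounded_bound[OF bX x xtX]
        by (intro add_mono mult_mono) (auto simp: dist_norm)
      also have "\<dots> = (1 + diameter X / r) * norm w" by (simp add: algebra_simps)
      also have "\<dots> \<le> (1 + diameter X / r) * (C * ?e)"
        using wb r diameter_ge_0[OF bX] by (intro mult_left_mono) auto
      finally show ?thesis by (simp add: mult.assoc)
    qed
    ultimately show "\<exists>x'\<in>X. (\<forall>l<\<nu>. inner (A l) x' = b l) \<and> norm (x - x') \<le> (1 + diameter X / r) * C * ?e"
      using eq by blast
  qed
qed

text \<open>Two repairs in sequence: first the equations, by the affine bound, then the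
  inequalities, by moving towards the strictly feasible \<open>xb\<close>, which keeps the equations
  solved. The first repair raises the inequality violation by at most Lipschitz constants times its
  length.\<close>

lemma feasible_set_error_bound:
  fixes X :: "'a::euclidean_space set" and A :: "nat \<Rightarrow> 'a"
  assumes X: "compact X" "convex X" and xt: "xt \<in> rel_interior X" "\<forall>l<\<nu>. inner (A l) xt = b l"
    and g: "\<forall>l<m. convex_on UNIV (g l)"
    and xb: "xb \<in> X" "\<forall>l<m. g l xb < 0" "\<forall>l<\<nu>. inner (A l) xb = b l"
  shows "\<exists>C\<ge>0. \<forall>x\<in>X. \<exists>x'\<in>feasible_set X m g \<nu> (\<lambda>l z. inner (A l) z - b l).
      norm (x - x') \<le> C * ((\<Sum>l<m. max 0 (g l x)) + (\<Sum>l<\<nu>. \<bar>inner (A l) x - b l\<bar>))"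
proof -
  have bX: "bounded X" using X compact_imp_bounded by blast
  obtain C where C: "0 \<le> C"
    "\<And>x. x \<in> X \<Longrightarrow> \<exists>x'\<in>X. (\<forall>l<\<nu>. inner (A l) x' = b l) \<and> norm (x - x') \<le> C * (\<Sum>l<\<nu>. \<bar>inner (A l) x - b l\<bar>)"
    using affine_error_bound[OF X xt] by blast
  have "\<exists>L. l < m \<longrightarrow> 0 \<le> L \<and> (\<forall>z\<in>X. \<forall>w\<in>X. \<bar>g l z - g l w\<bar> \<le> L * norm (z - w))" for l
  proof (cases "l < m")
    case True
    show ?thesis by (rule convex_on_UNIV_lipschitz[OF g[rule_format, OF True] X(1)]) blast
  qed blast
  then obtain L where L: "\<And>l. l < m \<Longrightarrow> 0 \<le> L l"
    "\<And>l z w. l < m \<Longrightarrow> z \<in> X \<Longrightarrow> w \<in> X \<Longrightarrow> \<bar>g l z - g l w\<bar> \<le> L l * norm (z - w)"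
    using choice[of "\<lambda>l L. l < m \<longrightarrow> 0 \<le> L \<and> (\<forall>z\<in>X. \<forall>w\<in>X. \<bar>g l z - g l w\<bar> \<le> L * norm (z - w))"]
    by blast
  \<comment> \<open>A uniform slack of the inequalities at \<open>xb\<close>; if there are none, it
    is set to 1.\<close>
  obtain c where c: "c > 0" "\<And>l. l < m \<Longrightarrow> g l xb \<le> - c"
  proof (cases "m = 0")
    case False
    let ?M = "Max ((\<lambda>l. g l xb) ` {..<m})"
    have "?M \<in> (\<lambda>l. g l xb) ` {..<m}" using False by (intro Max_in) auto
    then have "?M < 0" using xb(2) by auto
    then show thesis by (intro that[of "- ?M"]) (auto intro: Max_ge)
  qed (use that[of 1] in auto)
  define D where "D = diameter X / c"
  have D: "0 \<le> D" using diameter_ge_0[OF bX] c by (simp add: D_def)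
  define \<Lambda> where "\<Lambda> = (\<Sum>l<m. L l)"
  have \<Lambda>: "0 \<le> \<Lambda>" using L(1) by (auto simp: \<Lambda>_def intro: sum_nonneg)
  show ?thesis
  proof (intro exI[of _ "C + D * (1 + \<Lambda> * C)"] conjI ballI)
    show "0 \<le> C + D * (1 + \<Lambda> * C)" using C(1) D \<Lambda> by auto
    fix x assume x: "x \<in> X"
    let ?G = "\<Sum>l<m. max 0 (g l x)" and ?H = "\<Sum>l<\<nu>. \<bar>inner (A l) x - b l\<bar>"
    have GH: "0 \<le> ?G" "0 \<le> ?H" by (auto intro: sum_nonneg)
    obtain x' where x': "x' \<in> X" "\<forall>l<\<nu>. inner (A l) x' = b l" "norm (x - x') \<le> C * ?H"
      using C(2)[OF x] by blast
    define \<gamma> where "\<gamma> = (\<Sum>l<m. max 0 (g l x'))"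
    have \<gamma>0: "0 \<le> \<gamma>" by (auto simp: \<gamma>_def intro: sum_nonneg)
    have "\<gamma> \<le> (\<Sum>l<m. max 0 (g l x) + L l * norm (x - x'))"
      unfolding \<gamma>_def
    proof (rule sum_mono)
      fix l assume "l \<in> {..<m}"
      then have "\<bar>g l x - g l x'\<bar> \<le> L l * norm (x - x')" using L(2) x x' by auto
      then show "max 0 (g l x') \<le> max 0 (g l x) + L l * norm (x - x')" by linarith
    qed
    also have "\<dots> = ?G + \<Lambda> * norm (x - x')"
      by (simp add: sum.distrib \<Lambda>_def sum_distrib_right)
    also have "\<dots> \<le> ?G + \<Lambda> * (C * ?H)"
      using x'(3) \<Lambda> by (intro add_left_mono mult_left_mono)
    finally have \<gamma>: "\<gamma> \<le> ?G + \<Lambda> * (C * ?H)" .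
    \<comment> \<open>Chosen so that \<open>(1 - \<theta>) * \<gamma> = \<theta> * c\<close>: the
      slack at \<open>xb\<close> just absorbs the violation.\<close>
    define \<theta> where "\<theta> = \<gamma> / (\<gamma> + c)"
    have \<theta>: "0 \<le> \<theta>" "\<theta> \<le> 1"
      using \<gamma>0 c by (auto simp: \<theta>_def divide_le_eq add_nonneg_pos)
    have \<theta>c: "\<theta> \<le> \<gamma> / c"
      unfolding \<theta>_def using \<gamma>0 c by (intro divide_left_mono) (auto simp: add_nonneg_pos)
    define x'' where "x'' = (1 - \<theta>) *\<^sub>R x' + \<theta> *\<^sub>R xb"
    have "x'' \<in> X" using X(2) x' xb \<theta> by (auto simp: x''_def intro: convexD_alt)
    moreover have "inner (A l) x'' - b l = 0" if "l < \<nu>" for l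
      using x'(2) xb(3) that by (simp add: x''_def inner_add_right algebra_simps)
    moreover have "g l x'' \<le> 0" if l: "l < m" for l
    proof -
      have "g l x' \<le> max 0 (g l x')" by simp
      also have "\<dots> \<le> \<gamma>" unfolding \<gamma>_def using l by (intro member_le_sum) auto
      finally have "g l x' \<le> \<gamma>" .
      have "g l x'' \<le> (1 - \<theta>) * g l x' + \<theta> * g l xb"
        unfolding x''_def using convex_onD[OF g[rule_format, OF l], of \<theta> x' xb] \<theta> by simp
      also have "\<dots> \<le> (1 - \<theta>) * \<gamma> + \<theta> * (- c)"
        using \<theta> \<open>g l x' \<le> \<gamma>\<close> c(2)[OF l] by (intro add_mono mult_left_mono) auto
      also have "\<dots> = \<gamma> - \<theta> * (\<gamma> + c)" by (simp add: algebra_simps)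
      also have "\<dots> = 0" using \<gamma>0 c by (simp add: \<theta>_def)
      finally show ?thesis .
    qed
    moreover have "norm (x - x'') \<le> (C + D * (1 + \<Lambda> * C)) * (?G + ?H)"
    proof -
      have "x' - x'' = \<theta> *\<^sub>R (x' - xb)" by (simp add: x''_def algebra_simps)
      then have "norm (x' - x'') = \<theta> * norm (x' - xb)" using \<theta> by simp
      also have "\<dots> \<le> \<gamma> / c * diameter X"
        using \<theta> \<theta>c diameter_bounded_bound[OF bX x'(1) xb(1)] \<gamma>0 c
        by (intro mult_mono) (auto simp: dist_norm)
      also have "\<dots> = D * \<gamma>" by (simp add: D_def)
      also have "\<dots> \<le> D * (?G + \<Lambda> * (C * ?H))" using D \<gamma> by (intro mult_left_mono)
      finally have "norm (x - x'') \<le> C * ?H + D * (?G + \<Lambda> * (C * ?H))"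
        using x'(3) norm_triangle_ineq[of "x - x'" "x' - x''"] by simp
      also have "\<dots> \<le> (C + D * (1 + \<Lambda> * C)) * (?G + ?H)"
      proof -
        \<comment> \<open>These mixed products are exactly the difference of the two sides.\<close>
        have "0 \<le> C * ?G + D * ?H + D * \<Lambda> * C * ?G"
          using C(1) D \<Lambda> GH by (intro add_nonneg_nonneg mult_nonneg_nonneg)
        then show ?thesis by (simp add: algebra_simps)
      qed
      finally show ?thesis .
    qed
    ultimately show "\<exists>x'\<in>feasible_set X m g \<nu> (\<lambda>l z. inner (A l) z - b l).
        norm (x - x') \<le> (C + D * (1 + \<Lambda> * C)) * (?G + ?H)"
      by (intro bexI[of _ x'']) (auto simp: feasible_set_def)
  qed
qed

section \<open>Penalty primal-dual iteration\<close>

text \<open>Deterministic supermartingale argument: adding to \<open>A\<close> the part of the total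
  error not yet spent gives a decreasing nonnegative sequence, and telescoping bounds the partial
  sums of \<open>b\<close>.\<close>

lemma almost_decreasing_convergent:
  fixes A b c :: "nat \<Rightarrow> real"
  assumes A0: "\<And>k. 0 \<le> A k" and b0: "\<And>k. 0 \<le> b k" and c0: "\<And>k. 0 \<le> c k"
    and step: "\<And>k. A (Suc k) \<le> A k - b k + c k" and c: "summable c"
  shows "convergent A" "summable b"
proof -
  define U where "U k = A k + (suminf c - (\<Sum>l<k. c l))" for k
  have tail: "(\<Sum>l<k. c l) \<le> suminf c" for k
    using c c0 by (intro sum_le_suminf) auto
  have "U (Suc k) \<le> U k" for k using step[of k] b0[of k] by (simp add: U_def)
  then have "decseq U" by (simp add: decseq_Suc_iff)
  moreover have "0 \<le> U k" for k using A0[of k] tail[of k] by (simp add: U_def)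
  ultimately obtain L where "U \<longlonglongrightarrow> L" using decseq_convergent[of U 0] by metis
  moreover have "(\<lambda>k. \<Sum>l<k. c l) \<longlonglongrightarrow> suminf c" using c by (rule summable_LIMSEQ)
  ultimately have "(\<lambda>k. U k - (suminf c - (\<Sum>l<k. c l))) \<longlonglongrightarrow> L - (suminf c - suminf c)"
    by (intro tendsto_intros)
  then show "convergent A" unfolding convergent_def by (auto simp: U_def)
  have "A n + (\<Sum>k<n. b k) \<le> A 0 + (\<Sum>k<n. c k)" for n
  proof (induction n)
    case (Suc n)
    then show ?case using step[of n] by simp
  qed auto
  then have "(\<Sum>k<n. b k) \<le> A 0 + suminf c" for n
    using A0[of n] tail[of n] add_increasing[of "A n" "\<Sum>k<n. b k" "\<Sum>k<n. b k"] order.trans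
    by (meson add_left_mono order_refl)
  then show "summable b" using b0 by (intro summableI_nonneg_bounded) auto
qed

text \<open>If \<open>G\<close> stayed above a positive level from some time on, comparison would
  make \<alpha> summable. The times \<open>f n\<close> tend to infinity but need not
  increase.\<close>

lemma vanishing_along_times:
  fixes \<alpha> G :: "nat \<Rightarrow> real"
  assumes \<alpha>: "\<And>k. 0 < \<alpha> k" "\<not> summable \<alpha>" and G: "summable (\<lambda>k. \<alpha> k * G k)"
  obtains f :: "nat \<Rightarrow> nat" where "\<And>n. n \<le> f n" "\<And>n. G (f n) < 1 / (n + 1)"
proof -
  have "\<exists>k\<ge>K. G k < e" if e: "e > 0" for e K
  proof (rule ccontr)
    assume "\<not> ?thesis"
    then have "\<alpha> k * e \<le> \<alpha> k * G k" if "k \<ge> K" for k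
      using \<alpha>(1)[of k] that by (intro mult_left_mono) (auto simp: not_less)
    then have "norm (\<alpha> k) \<le> \<alpha> k * G k / e" if "k \<ge> K" for k
      using \<alpha>(1)[of k] e that by (simp add: pos_le_divide_eq)
    with summable_divide[OF G, of e] have "summable \<alpha>" by (rule summable_comparison_test')
    with \<alpha> show False by simp
  qed
  then have "\<forall>n. \<exists>k. n \<le> k \<and> G k < 1 / (real n + 1)" by simp
  then obtain f where "\<And>n. n \<le> f n \<and> G (f n) < 1 / (real n + 1)" by metis
  then show thesis using that by blast
qed

text \<open>Merges bounds found index by index into one constant; since \<open>P\<close> is upward
  closed, a sum of bounds serves all indices.\<close>

lemma uniform_bound_lessThan:
  fixes n :: nat
  assumes "\<And>i. i < n \<Longrightarrow> \<exists>C::real. 0 \<le> C \<and> P i C" and mono: "\<And>i C D. P i C \<Longrightarrow> C \<le> D \<Longrightarrow> P i D"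
  shows "\<exists>C\<ge>0. \<forall>i<n. P i C"
proof -
  have "\<forall>i<n. \<exists>C\<ge>0. P i C" using assms(1) by blast
  then show ?thesis
  proof (induction n)
    case (Suc n)
    then obtain C where C: "0 \<le> C" "\<forall>i<n. P i C" by auto
    obtain D where D: "0 \<le> D" "P n D" using Suc.prems by blast
    have "P i (C + D)" if "i < Suc n" for i
      using that C D mono[of i C "C + D"] mono[of i D "C + D"] by (cases "i = n") auto
    then show ?case using C(1) D(1) by (intro exI[of _ "C + D"]) auto
  qed auto
qed

text \<open>The projection is nonexpansive and fixes \<open>xs\<close>; the rest expands a
  square.\<close>

lemma projected_step_le:
  fixes X :: "'a::euclidean_space set"
  assumes "closed X" "convex X" "xs \<in> X"
  shows "(norm (closest_point X (v - t *\<^sub>R d) - xs))\<^sup>2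
    \<le> (norm (v - xs))\<^sup>2 - 2 * t * inner d (v - xs) + t\<^sup>2 * (norm d)\<^sup>2"
proof -
  have "norm (closest_point X (v - t *\<^sub>R d) - xs) \<le> norm ((v - xs) - t *\<^sub>R d)"
    using closest_point_lipschitz[of X "v - t *\<^sub>R d" xs] assms
    by (auto simp: closest_point_self dist_norm algebra_simps)
  then have "(norm (closest_point X (v - t *\<^sub>R d) - xs))\<^sup>2 \<le> (norm ((v - xs) - t *\<^sub>R d))\<^sup>2"
    by (intro power_mono) auto
  also have "\<dots> = (norm (v - xs))\<^sup>2 - 2 * t * inner d (v - xs) + t\<^sup>2 * (norm d)\<^sup>2"
    unfolding power2_norm_eq_inner
    by (simp add: inner_diff_left inner_diff_right inner_commute[of v d] inner_commute[of xs d]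
        power2_eq_square algebra_simps)
  finally show ?thesis .
qed

text \<open>Both kinds of constraints are merged into one family \<open>q\<close> of nonnegative
  convex violations with multipliers \<open>w\<close>. The constraint qualification appears only
  through its consequence \<open>exact_penalty\<close>.\<close>

locale penalty_primal_dual = balanced_network N a \<eta> B for N a \<eta> B +
  fixes X :: "'a::euclidean_space set" and fi :: "nat \<Rightarrow> 'a \<Rightarrow> real"
    and M :: nat and q :: "nat \<Rightarrow> 'a \<Rightarrow> real" and \<kappa> p :: real
    and \<alpha> :: "nat \<Rightarrow> real"
    and x vx :: "nat \<Rightarrow> nat \<Rightarrow> 'a" and w vw :: "nat \<Rightarrow> nat \<Rightarrow> nat \<Rightarrow> real"
    and Df :: "nat \<Rightarrow> nat \<Rightarrow> 'a" and Dq :: "nat \<Rightarrow> nat \<Rightarrow> nat \<Rightarrow> 'a"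
  assumes X_compact: "compact X" and X_convex: "convex X"
    and fi_convex: "i < N \<Longrightarrow> convex_on UNIV (fi i)"
    and q_convex: "l < M \<Longrightarrow> convex_on UNIV (q l)"
    and q_nonneg: "l < M \<Longrightarrow> 0 \<le> q l z"
    and \<kappa>_nonneg: "0 \<le> \<kappa>"
    and exact_penalty: "z \<in> X \<Longrightarrow> p \<le> (\<Sum>i<N. fi i z) + \<kappa> * (\<Sum>l<M. q l z)"
    and optimum_exists: "\<exists>z\<in>X. (\<forall>l<M. q l z = 0) \<and> (\<Sum>i<N. fi i z) = p"
    and \<alpha>_pos: "0 < \<alpha> k"
    and \<alpha>_not_summable: "\<not> summable \<alpha>"
    and step_square_summable: "summable (\<lambda>k. (\<alpha> k * (1 + (\<Sum>l<k. \<alpha> l)))\<^sup>2)"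
    and x_init: "i < N \<Longrightarrow> x i 0 \<in> X"
    and w_init: "i < N \<Longrightarrow> l < M \<Longrightarrow> 0 \<le> w i 0 l"
    and vx_eq: "vx i k = (\<Sum>j<N. a k i j *\<^sub>R x j k)"
    and vw_eq: "vw i k l = (\<Sum>j<N. a k i j * w j k l)"
    and Df_subgradient: "i < N \<Longrightarrow> is_subgradient (fi i) (vx i k) (Df i k)"
    and Dq_subgradient: "i < N \<Longrightarrow> l < M \<Longrightarrow> is_subgradient (q l) (vx i k) (Dq i k l)"
    and x_step: "i < N \<Longrightarrow> x i (Suc k)
      = closest_point X (vx i k - \<alpha> k *\<^sub>R (Df i k + (\<Sum>l<M. vw i k l *\<^sub>R Dq i k l)))"
    and w_step: "i < N \<Longrightarrow> l < M \<Longrightarrow> w i (Suc k) l = vw i k l + \<alpha> k * q l (vx i k)"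
begin

text \<open>The multipliers grow at most like one plus the partial sums of the step sizes, so this
  is the order of the length of a primal step.\<close>

definition \<rho> :: "nat \<Rightarrow> real" where "\<rho> k = \<alpha> k * (1 + (\<Sum>l<k. \<alpha> l))"

definition pen :: "'a \<Rightarrow> real" where "pen z = (\<Sum>l<M. q l z)"

text \<open>The weight exceeds the threshold \<open>\<kappa>\<close> by one, so that the gap
  dominates \<open>pen\<close> on \<open>X\<close>.\<close>

definition gap :: "'a \<Rightarrow> real" where "gap z = (\<Sum>i<N. fi i z) - p + (\<kappa> + 1) * pen z"

definition optimal :: "'a set" where "optimal = {z \<in> X. (\<forall>l<M. q l z = 0) \<and> (\<Sum>i<N. fi i z) = p}"

definition direction :: "nat \<Rightarrow> nat \<Rightarrow> 'a" where
  "direction i k = Df i k + (\<Sum>l<M. vw i k l *\<^sub>R Dq i k l)"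

text \<open>The reference multiplier exceeds the exact penalty threshold, so that the gap vanishes only at
  optimal points.\<close>
definition c :: real where "c = (\<kappa> + 1) / N"

definition lyapunov :: "'a \<Rightarrow> nat \<Rightarrow> real" where
  "lyapunov xs k = (\<Sum>i<N. (norm (x i k - xs))\<^sup>2 + (\<Sum>l<M. (w i k l - c)\<^sup>2))"

section \<open>Invariants and a priori bounds of the iteration\<close>

lemma X_closed: "closed X" using X_compact compact_imp_closed by blast

lemma X_nonempty: "X \<noteq> {}" using x_init[of 0] N_pos by auto

lemma x_in_X: "i < N \<Longrightarrow> x i k \<in> X"
  by (induction k) (auto simp: x_init x_step closest_point_in_set X_closed X_nonempty)

lemma vx_in_X: "i < N \<Longrightarrow> vx i k \<in> X"
  unfolding vx_eq by (intro convex_sum X_convex) (auto simp: row_sum weight_nonneg x_in_X)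

lemma w_nonneg: "i < N \<Longrightarrow> l < M \<Longrightarrow> 0 \<le> w i k l"
  using \<alpha>_pos by (induction k arbitrary: i)
    (auto simp: w_init w_step vw_eq weight_nonneg q_nonneg less_imp_le intro!: add_nonneg_nonneg sum_nonneg)

lemma vw_nonneg: "i < N \<Longrightarrow> l < M \<Longrightarrow> 0 \<le> vw i k l"
  by (auto simp: vw_eq weight_nonneg w_nonneg intro!: sum_nonneg)

lemma pen_nonneg: "0 \<le> pen z" by (auto simp: pen_def q_nonneg intro: sum_nonneg)

lemma pen_le_gap: "z \<in> X \<Longrightarrow> pen z \<le> gap z"
  using exact_penalty[of z] by (simp add: gap_def pen_def algebra_simps)

lemma \<alpha>_le_\<rho>: "\<alpha> k \<le> \<rho> k"
  using \<alpha>_pos by (auto simp: \<rho>_def algebra_simps less_imp_le sum_nonneg)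

lemma \<rho>_nonneg: "0 \<le> \<rho> k" using \<alpha>_le_\<rho>[of k] \<alpha>_pos[of k] by simp

lemma \<rho>_square_summable: "summable (\<lambda>k. (\<rho> k)\<^sup>2)"
  using step_square_summable by (simp add: \<rho>_def)

lemma q_bounded: "\<exists>C\<ge>0. \<forall>l<M. \<forall>z\<in>X. q l z \<le> C"
proof (rule uniform_bound_lessThan)
  fix l assume l: "l < M"
  show "\<exists>C::real. 0 \<le> C \<and> (\<forall>z\<in>X. q l z \<le> C)"
  proof (rule convex_on_UNIV_bounded_near[OF q_convex[OF l] X_compact])
    fix C :: real assume C: "0 \<le> C" "\<And>z u. z \<in> X \<Longrightarrow> norm u \<le> 1 \<Longrightarrow> \<bar>q l (z + u)\<bar> \<le> C"
    have "q l z \<le> C" if "z \<in> X" for z using C(2)[OF that, of 0] by simp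
    then show ?thesis using C(1) by blast
  qed
qed force

lemma q_lipschitz: "\<exists>L\<ge>0. \<forall>l<M. \<forall>z\<in>X. \<forall>y\<in>X. q l z \<le> q l y + L * norm (z - y)"
proof (rule uniform_bound_lessThan)
  fix l assume l: "l < M"
  show "\<exists>L::real. 0 \<le> L \<and> (\<forall>z\<in>X. \<forall>y\<in>X. q l z \<le> q l y + L * norm (z - y))"
    by (rule convex_on_UNIV_lipschitz[OF q_convex[OF l] X_compact]) (force simp: abs_le_iff)
qed (meson add_left_mono mult_right_mono norm_ge_zero order.trans)

lemma fi_lipschitz: "\<exists>L\<ge>0. \<forall>i<N. \<forall>z\<in>X. \<forall>y\<in>X. fi i z \<le> fi i y + L * norm (z - y)"
proof (rule uniform_bound_lessThan)
  fix i assume i: "i < N"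
  show "\<exists>L::real. 0 \<le> L \<and> (\<forall>z\<in>X. \<forall>y\<in>X. fi i z \<le> fi i y + L * norm (z - y))"
    by (rule convex_on_UNIV_lipschitz[OF fi_convex[OF i] X_compact]) (force simp: abs_le_iff)
qed (meson add_left_mono mult_right_mono norm_ge_zero order.trans)

lemma Df_bounded: "\<exists>C\<ge>0. \<forall>i<N. \<forall>k. norm (Df i k) \<le> C"
proof (rule uniform_bound_lessThan)
  fix i assume i: "i < N"
  show "\<exists>C::real. 0 \<le> C \<and> (\<forall>k. norm (Df i k) \<le> C)"
    by (rule subgradients_bounded[OF fi_convex[OF i] X_compact])
      (use vx_in_X[OF i] Df_subgradient[OF i] in blast)
qed (meson order.trans)

lemma Dq_bounded: "\<exists>C\<ge>0. \<forall>l<M. \<forall>i<N. \<forall>k. norm (Dq i k l) \<le> C"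
proof (rule uniform_bound_lessThan)
  fix l assume l: "l < M"
  show "\<exists>C::real. 0 \<le> C \<and> (\<forall>i<N. \<forall>k. norm (Dq i k l) \<le> C)"
    by (rule subgradients_bounded[OF q_convex[OF l] X_compact])
      (use vx_in_X Dq_subgradient l in blast)
qed (meson order.trans)

text \<open>Averaging never raises the largest multiplier, and a step adds at most
  \<open>\<alpha> k\<close> times the bound of \<open>q\<close> on the compact set
  \<open>X\<close>.\<close>

lemma vw_growth: "\<exists>C\<ge>0. \<forall>k. \<forall>i<N. \<forall>l<M. vw i k l \<le> C * (1 + (\<Sum>t<k. \<alpha> t))"
proof -
  obtain Cq where Cq: "0 \<le> Cq" "\<forall>l<M. \<forall>z\<in>X. q l z \<le> Cq" using q_bounded by blast
  \<comment> \<open>Large enough for both the increments and every initial multiplier.\<close>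
  define C where "C = Cq + (\<Sum>i<N. \<Sum>l<M. w i 0 l)"
  have C: "Cq \<le> C" "0 \<le> C" unfolding C_def using Cq by (auto intro!: add_nonneg_nonneg sum_nonneg w_init)
  have init: "w i 0 l \<le> C" if "i < N" "l < M" for i l
  proof -
    have "w i 0 l \<le> (\<Sum>l<M. w i 0 l)" using that by (intro member_le_sum) (auto simp: w_init)
    also have "\<dots> \<le> (\<Sum>i<N. \<Sum>l<M. w i 0 l)"
      using that by (intro member_le_sum[of i "{..<N}" "\<lambda>i. \<Sum>l<M. w i 0 l"]) (auto simp: w_init intro!: sum_nonneg)
    finally show ?thesis using Cq by (simp add: C_def)
  qed
  have mix: "vw i k l \<le> d" if "i < N" "\<And>j. j < N \<Longrightarrow> w j k l \<le> d" for i k l d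
  proof -
    have "vw i k l \<le> (\<Sum>j<N. a k i j * d)"
      unfolding vw_eq using that by (intro sum_mono mult_left_mono) (auto simp: weight_nonneg)
    then show ?thesis using that(1) by (simp add: row_sum flip: sum_distrib_right)
  qed
  have "w i k l \<le> C * (1 + (\<Sum>t<k. \<alpha> t))" if l: "l < M" and "i < N" for i k l
    using that(2)
  proof (induction k arbitrary: i)
    case (Suc k)
    have "q l (vx i k) \<le> Cq" using Cq(2) l vx_in_X[OF Suc.prems] by blast
    then have "\<alpha> k * q l (vx i k) \<le> \<alpha> k * C"
      using C(1) \<alpha>_pos[of k] by (intro mult_left_mono) auto
    moreover have "vw i k l \<le> C * (1 + (\<Sum>t<k. \<alpha> t))" using Suc by (intro mix) auto
    ultimately show ?case using Suc.prems l by (simp add: w_step algebra_simps)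
  qed (use init l in auto)
  then show ?thesis using C(2) by (intro exI[of _ C]) (auto intro!: mix)
qed

text \<open>The subgradients are bounded on \<open>X\<close>, so only the multipliers can make the
  direction grow, and \<open>\<rho>\<close> accounts for their growth.\<close>

lemma direction_bounded: "\<exists>C\<ge>0. \<forall>k. \<forall>i<N. \<alpha> k * norm (direction i k) \<le> C * \<rho> k"
proof -
  obtain Cf where Cf: "0 \<le> Cf" "\<forall>i<N. \<forall>k. norm (Df i k) \<le> Cf" using Df_bounded by blast
  obtain Cq where Cq: "0 \<le> Cq" "\<forall>l<M. \<forall>i<N. \<forall>k. norm (Dq i k l) \<le> Cq" using Dq_bounded by blast
  obtain Cw where Cw: "0 \<le> Cw" "\<forall>k. \<forall>i<N. \<forall>l<M. vw i k l \<le> Cw * (1 + (\<Sum>t<k. \<alpha> t))"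
    using vw_growth by blast
  have "\<alpha> k * norm (direction i k) \<le> (Cf + M * (Cw * Cq)) * \<rho> k" if i: "i < N" for i k
  proof -
    let ?s = "1 + (\<Sum>t<k. \<alpha> t)"
    have s: "1 \<le> ?s" using \<alpha>_pos by (auto intro!: sum_nonneg simp: less_imp_le)
    have "norm (\<Sum>l<M. vw i k l *\<^sub>R Dq i k l) \<le> (\<Sum>l<M. (Cw * ?s) * Cq)"
      using i Cw Cq s vw_nonneg by (intro sum_norm_le) (auto intro!: mult_mono)
    then have "norm (direction i k) \<le> Cf + (\<Sum>l<M. (Cw * ?s) * Cq)"
      unfolding direction_def using Cf i by (intro norm_triangle_mono) auto
    also have "\<dots> = Cf * 1 + (M * (Cw * Cq)) * ?s" by simp
    also have "\<dots> \<le> Cf * ?s + (M * (Cw * Cq)) * ?s"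
      using Cf(1) s by (intro add_right_mono mult_left_mono)
    also have "\<dots> = (Cf + M * (Cw * Cq)) * ?s" by (simp add: algebra_simps)
    finally have "\<alpha> k * norm (direction i k) \<le> \<alpha> k * ((Cf + M * (Cw * Cq)) * ?s)"
      using \<alpha>_pos[of k] by (intro mult_left_mono) auto
    then show ?thesis by (simp add: \<rho>_def algebra_simps)
  qed
  then show ?thesis
    using Cf(1) Cq(1) Cw(1) by (intro exI[of _ "Cf + M * (Cw * Cq)"]) auto
qed

section \<open>Square summable disagreement of states and multipliers\<close>

lemma x_perturbation: "i < N \<Longrightarrow> norm (x i (Suc k) - vx i k) \<le> \<alpha> k * norm (direction i k)"
  \<comment> \<open>\<open>vx i k\<close> lies in \<open>X\<close> and is fixed by the projection,
    so nonexpansiveness leaves only the length of the step.\<close>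
  using closest_point_lipschitz[OF X_convex X_closed X_nonempty, of "vx i k - \<alpha> k *\<^sub>R direction i k" "vx i k"]
    \<alpha>_pos[of k]
  by (simp add: x_step direction_def closest_point_self vx_in_X dist_norm)

lemma x_disagreement_square_summable: "summable (\<lambda>k. (disagreement x k)\<^sup>2)"
proof -
  obtain C where C: "0 \<le> C" "\<forall>k. \<forall>i<N. \<alpha> k * norm (direction i k) \<le> C * \<rho> k"
    using direction_bounded by blast
  show ?thesis
  proof (rule disagreement_square_summable)
    show "norm (x i (Suc k) - (\<Sum>j<N. a k i j *\<^sub>R x j k)) \<le> C * \<rho> k" if "i < N" for i k
      using x_perturbation[OF that, of k] C(2) that unfolding vx_eq[symmetric]
      by (meson order.trans)
    show "summable (\<lambda>k. (C * \<rho> k)\<^sup>2)"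
      using \<rho>_square_summable by (simp add: power_mult_distrib summable_mult)
  qed
qed

lemma w_disagreement_square_summable:
  assumes l: "l < M" shows "summable (\<lambda>k. (disagreement (\<lambda>i k. w i k l) k)\<^sup>2)"
proof -
  obtain C where C: "0 \<le> C" "\<forall>l<M. \<forall>z\<in>X. q l z \<le> C" using q_bounded by blast
  show ?thesis
  proof (rule disagreement_square_summable)
    show "norm (w i (Suc k) l - (\<Sum>j<N. a k i j *\<^sub>R w j k l)) \<le> C * \<rho> k" if i: "i < N" for i k
    proof -
      have "norm (w i (Suc k) l - (\<Sum>j<N. a k i j *\<^sub>R w j k l)) = \<alpha> k * q l (vx i k)"
        using i l \<alpha>_pos[of k] by (simp add: w_step vw_eq q_nonneg)
      also have "\<dots> \<le> \<rho> k * C"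
        using C l vx_in_X[OF i] q_nonneg \<alpha>_le_\<rho> \<rho>_nonneg by (intro mult_mono) auto
      finally show ?thesis by (simp add: mult.commute)
    qed
    show "summable (\<lambda>k. (C * \<rho> k)\<^sup>2)"
      using \<rho>_square_summable by (simp add: power_mult_distrib summable_mult)
  qed
qed

section \<open>Descent of the Lyapunov function\<close>

lemma direction_inner_ge:
  assumes i: "i < N" and xs: "xs \<in> optimal"
  shows "fi i (vx i k) - fi i xs + (\<Sum>l<M. vw i k l * q l (vx i k)) \<le> inner (direction i k) (vx i k - xs)"
proof -
  have "fi i (vx i k) - fi i xs \<le> inner (Df i k) (vx i k - xs)"
    using Df_subgradient[OF i, of k] unfolding is_subgradient_def
    by (smt (verit) inner_diff_right)
  moreover have "vw i k l * q l (vx i k) \<le> vw i k l * inner (Dq i k l) (vx i k - xs)" if l: "l < M" for l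
  proof (intro mult_left_mono vw_nonneg i l)
    \<comment> \<open>The violations vanish at an optimal point, so the subgradient inequality
      bounds \<open>q l (vx i k)\<close> itself.\<close>
    have "q l xs = 0" using xs l by (simp add: optimal_def)
    then show "q l (vx i k) \<le> inner (Dq i k l) (vx i k - xs)"
      using Dq_subgradient[OF i l, of k] unfolding is_subgradient_def
      by (smt (verit) inner_diff_right)
  qed
  then have "(\<Sum>l<M. vw i k l * q l (vx i k)) \<le> (\<Sum>l<M. vw i k l * inner (Dq i k l) (vx i k - xs))"
    by (intro sum_mono) auto
  ultimately show ?thesis
    by (simp add: direction_def inner_add_left inner_sum_left)
qed

text \<open>The terms coupling the current multipliers with the constraint violation cancel between the
  primal and the dual step; only the fixed reference multiplier remains.\<close>
lemma agent_step_le: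
  "\<exists>C\<ge>0. \<forall>k. \<forall>i<N. \<forall>xs\<in>optimal.
     (norm (x i (Suc k) - xs))\<^sup>2 + (\<Sum>l<M. (w i (Suc k) l - c)\<^sup>2)
     \<le> (norm (vx i k - xs))\<^sup>2 + (\<Sum>l<M. (vw i k l - c)\<^sup>2)
       - 2 * \<alpha> k * (fi i (vx i k) - fi i xs + c * pen (vx i k)) + C * (\<rho> k)\<^sup>2"
proof -
  obtain Cd where Cd: "0 \<le> Cd" "\<forall>k. \<forall>i<N. \<alpha> k * norm (direction i k) \<le> Cd * \<rho> k"
    using direction_bounded by blast
  obtain Cq where Cq: "0 \<le> Cq" "\<forall>l<M. \<forall>z\<in>X. q l z \<le> Cq" using q_bounded by blast
  have "(norm (x i (Suc k) - xs))\<^sup>2 + (\<Sum>l<M. (w i (Suc k) l - c)\<^sup>2)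
     \<le> (norm (vx i k - xs))\<^sup>2 + (\<Sum>l<M. (vw i k l - c)\<^sup>2)
       - 2 * \<alpha> k * (fi i (vx i k) - fi i xs + c * pen (vx i k)) + (Cd\<^sup>2 + M * Cq\<^sup>2) * (\<rho> k)\<^sup>2"
    if i: "i < N" and xs: "xs \<in> optimal" for i k xs
  proof -
    let ?Q = "\<Sum>l<M. vw i k l * q l (vx i k)"
    have xsX: "xs \<in> X" using xs by (simp add: optimal_def)
    have "(\<alpha> k * norm (direction i k))\<^sup>2 \<le> (Cd * \<rho> k)\<^sup>2"
      using Cd i \<alpha>_pos[of k] by (intro power_mono) auto
    then have d2: "(\<alpha> k)\<^sup>2 * (norm (direction i k))\<^sup>2 \<le> Cd\<^sup>2 * (\<rho> k)\<^sup>2"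
      by (simp add: power_mult_distrib)
    have "(norm (x i (Suc k) - xs))\<^sup>2 \<le> (norm (vx i k - xs))\<^sup>2
        - 2 * \<alpha> k * inner (direction i k) (vx i k - xs) + (\<alpha> k)\<^sup>2 * (norm (direction i k))\<^sup>2"
      using projected_step_le[OF X_closed X_convex xsX] i by (simp add: x_step direction_def)
    moreover have "2 * \<alpha> k * (fi i (vx i k) - fi i xs + ?Q)
        \<le> 2 * \<alpha> k * inner (direction i k) (vx i k - xs)"
      using direction_inner_ge[OF i xs] \<alpha>_pos[of k] by (intro mult_left_mono) auto
    ultimately have primal: "(norm (x i (Suc k) - xs))\<^sup>2 \<le> (norm (vx i k - xs))\<^sup>2
        - 2 * \<alpha> k * (fi i (vx i k) - fi i xs + ?Q) + Cd\<^sup>2 * (\<rho> k)\<^sup>2"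
      using d2 by linarith
    have "(\<Sum>l<M. (w i (Suc k) l - c)\<^sup>2) \<le> (\<Sum>l<M. (vw i k l - c)\<^sup>2
        + 2 * \<alpha> k * (vw i k l * q l (vx i k)) - 2 * \<alpha> k * c * q l (vx i k) + Cq\<^sup>2 * (\<rho> k)\<^sup>2)"
    proof (rule sum_mono)
      fix l assume "l \<in> {..<M}"
      then have l: "l < M" by simp
      have "\<alpha> k * q l (vx i k) \<le> \<rho> k * Cq"
        using Cq l vx_in_X[OF i] q_nonneg \<alpha>_le_\<rho> \<rho>_nonneg by (intro mult_mono) auto
      then have "(\<alpha> k * q l (vx i k))\<^sup>2 \<le> (\<rho> k * Cq)\<^sup>2"
        using \<alpha>_pos[of k] q_nonneg[OF l] by (intro power_mono) auto
      then have "(\<alpha> k * q l (vx i k))\<^sup>2 \<le> Cq\<^sup>2 * (\<rho> k)\<^sup>2"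
        by (simp add: power_mult_distrib mult.commute)
      then show "(w i (Suc k) l - c)\<^sup>2 \<le> (vw i k l - c)\<^sup>2
        + 2 * \<alpha> k * (vw i k l * q l (vx i k)) - 2 * \<alpha> k * c * q l (vx i k) + Cq\<^sup>2 * (\<rho> k)\<^sup>2"
        using i l by (simp add: w_step power2_eq_square algebra_simps)
    qed
    also have "\<dots> = (\<Sum>l<M. (vw i k l - c)\<^sup>2) + 2 * \<alpha> k * ?Q - 2 * \<alpha> k * c * pen (vx i k)
        + M * (Cq\<^sup>2 * (\<rho> k)\<^sup>2)"
      by (simp add: sum.distrib sum_subtractf sum_distrib_left pen_def)
    finally show ?thesis using primal by (simp add: algebra_simps)
  qed
  then show ?thesis using Cd Cq by (intro exI[of _ "Cd\<^sup>2 + M * Cq\<^sup>2"]) auto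
qed

text \<open>Replacing each mixed point by the state of agent 0 costs Lipschitz constants times the
  disagreement. At this common point the local terms add up to the gap because
  \<open>N * c = \<kappa> + 1\<close>.\<close>

lemma network_gap_ge:
  "\<exists>C\<ge>0. \<forall>k. \<forall>xs\<in>optimal. gap (x 0 k) - C * disagreement x k
    \<le> (\<Sum>i<N. fi i (vx i k) - fi i xs + c * pen (vx i k))"
proof -
  obtain Lf where Lf: "0 \<le> Lf" "\<forall>i<N. \<forall>z\<in>X. \<forall>y\<in>X. fi i z \<le> fi i y + Lf * norm (z - y)"
    using fi_lipschitz by blast
  obtain Lq where Lq: "0 \<le> Lq" "\<forall>l<M. \<forall>z\<in>X. \<forall>y\<in>X. q l z \<le> q l y + Lq * norm (z - y)"
    using q_lipschitz by blast
  have c0: "0 \<le> c" using \<kappa>_nonneg by (simp add: c_def)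
  have "gap (x 0 k) - N * (Lf + c * (M * Lq)) * disagreement x k
    \<le> (\<Sum>i<N. fi i (vx i k) - fi i xs + c * pen (vx i k))" if xs: "xs \<in> optimal" for k xs
  proof -
    let ?V = "disagreement x k"
    have x0: "x 0 k \<in> X" using x_in_X N_pos by auto
    have "fi i (x 0 k) - fi i xs + c * pen (x 0 k) - (Lf + c * (M * Lq)) * ?V
        \<le> fi i (vx i k) - fi i xs + c * pen (vx i k)" if i: "i < N" for i
    proof -
      have near: "norm (x 0 k - vx i k) \<le> ?V"
        using mix_near[OF i, of 0 k x] N_pos by (simp add: vx_eq norm_minus_commute)
      have "fi i (x 0 k) \<le> fi i (vx i k) + Lf * norm (x 0 k - vx i k)"
        using Lf(2) i x0 vx_in_X[OF i] by blast
      also have "\<dots> \<le> fi i (vx i k) + Lf * ?V" using near Lf(1) by (intro add_left_mono mult_left_mono)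
      finally have f: "fi i (x 0 k) \<le> fi i (vx i k) + Lf * ?V" .
      have "pen (x 0 k) \<le> (\<Sum>l<M. q l (vx i k) + Lq * ?V)"
        unfolding pen_def
      proof (rule sum_mono)
        fix l assume "l \<in> {..<M}"
        then have "q l (x 0 k) \<le> q l (vx i k) + Lq * norm (x 0 k - vx i k)"
          using Lq(2) x0 vx_in_X[OF i] by blast
        also have "\<dots> \<le> q l (vx i k) + Lq * ?V" using near Lq(1) by (intro add_left_mono mult_left_mono)
        finally show "q l (x 0 k) \<le> q l (vx i k) + Lq * ?V" .
      qed
      also have "\<dots> = pen (vx i k) + M * Lq * ?V" by (simp add: pen_def sum.distrib)
      finally have "c * pen (x 0 k) \<le> c * (pen (vx i k) + M * Lq * ?V)" using c0 by (intro mult_left_mono)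
      with f show ?thesis by (simp add: algebra_simps)
    qed
    then have "(\<Sum>i<N. fi i (x 0 k) - fi i xs + c * pen (x 0 k) - (Lf + c * (M * Lq)) * ?V)
        \<le> (\<Sum>i<N. fi i (vx i k) - fi i xs + c * pen (vx i k))"
      by (intro sum_mono) auto
    moreover have "(\<Sum>i<N. fi i (x 0 k) - fi i xs + c * pen (x 0 k) - (Lf + c * (M * Lq)) * ?V)
        = gap (x 0 k) - N * (Lf + c * (M * Lq)) * ?V"
    proof -
      have "N * c = \<kappa> + 1" using N_pos by (simp add: c_def)
      moreover have "(\<Sum>i<N. fi i xs) = p" using xs by (simp add: optimal_def)
      ultimately show ?thesis by (simp add: gap_def sum.distrib sum_subtractf flip: mult.assoc)
    qed
    ultimately show ?thesis by simp
  qed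
  then show ?thesis
    using Lf(1) Lq(1) c0 by (intro exI[of _ "N * (Lf + c * (M * Lq))"]) auto
qed

text \<open>In the sum of the agent steps, mixing does not increase the squared distances, and the
  product of step size and disagreement is split into two summable squares.\<close>

lemma lyapunov_step:
  "\<exists>C\<ge>0. \<forall>k. \<forall>xs\<in>optimal. lyapunov xs (Suc k)
     \<le> lyapunov xs k - 2 * \<alpha> k * gap (x 0 k) + C * ((\<rho> k)\<^sup>2 + (disagreement x k)\<^sup>2)"
proof -
  obtain C1 where C1: "0 \<le> C1" "\<forall>k. \<forall>i<N. \<forall>xs\<in>optimal.
     (norm (x i (Suc k) - xs))\<^sup>2 + (\<Sum>l<M. (w i (Suc k) l - c)\<^sup>2)
     \<le> (norm (vx i k - xs))\<^sup>2 + (\<Sum>l<M. (vw i k l - c)\<^sup>2)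
       - 2 * \<alpha> k * (fi i (vx i k) - fi i xs + c * pen (vx i k)) + C1 * (\<rho> k)\<^sup>2"
    using agent_step_le by blast
  obtain C2 where C2: "0 \<le> C2" "\<forall>k. \<forall>xs\<in>optimal. gap (x 0 k) - C2 * disagreement x k
    \<le> (\<Sum>i<N. fi i (vx i k) - fi i xs + c * pen (vx i k))"
    using network_gap_ge by blast
  have "lyapunov xs (Suc k)
     \<le> lyapunov xs k - 2 * \<alpha> k * gap (x 0 k) + (N * C1 + C2) * ((\<rho> k)\<^sup>2 + (disagreement x k)\<^sup>2)"
    if xs: "xs \<in> optimal" for k xs
  proof -
    let ?V = "disagreement x k"
    let ?g = "\<lambda>i. fi i (vx i k) - fi i xs + c * pen (vx i k)"
    have "lyapunov xs (Suc k) \<le> (\<Sum>i<N. (norm (vx i k - xs))\<^sup>2 + (\<Sum>l<M. (vw i k l - c)\<^sup>2)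
       - 2 * \<alpha> k * ?g i + C1 * (\<rho> k)\<^sup>2)"
      unfolding lyapunov_def using C1 xs by (intro sum_mono) auto
    also have "\<dots> = (\<Sum>i<N. (norm (vx i k - xs))\<^sup>2) + (\<Sum>i<N. \<Sum>l<M. (vw i k l - c)\<^sup>2)
       - 2 * \<alpha> k * (\<Sum>i<N. ?g i) + N * (C1 * (\<rho> k)\<^sup>2)"
      by (simp add: sum.distrib sum_subtractf flip: sum_distrib_left)
    also have "(\<Sum>i<N. (norm (vx i k - xs))\<^sup>2) \<le> (\<Sum>i<N. (norm (x i k - xs))\<^sup>2)"
      unfolding vx_eq by (rule sum_norm_square_mix_le)
    also have "(\<Sum>i<N. \<Sum>l<M. (vw i k l - c)\<^sup>2) \<le> (\<Sum>i<N. \<Sum>l<M. (w i k l - c)\<^sup>2)"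
    proof -
      \<comment> \<open>The sums are swapped because the mixing inequality treats one multiplier
        component at a time.\<close>
      have "(\<Sum>l<M. \<Sum>i<N. (vw i k l - c)\<^sup>2) \<le> (\<Sum>l<M. \<Sum>i<N. (w i k l - c)\<^sup>2)"
      proof (rule sum_mono)
        fix l
        show "(\<Sum>i<N. (vw i k l - c)\<^sup>2) \<le> (\<Sum>i<N. (w i k l - c)\<^sup>2)"
          using sum_norm_square_mix_le[of k "\<lambda>j. w j k l" c] by (simp add: vw_eq)
      qed
      then show ?thesis by (subst (1 2) sum.swap)
    qed
    also have "(\<Sum>i<N. (norm (x i k - xs))\<^sup>2) + (\<Sum>i<N. \<Sum>l<M. (w i k l - c)\<^sup>2) = lyapunov xs k"
      by (simp add: lyapunov_def sum.distrib)
    finally have 1: "lyapunov xs (Suc k) \<le> lyapunov xs k - 2 * \<alpha> k * (\<Sum>i<N. ?g i) + N * (C1 * (\<rho> k)\<^sup>2)"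
      by simp
    have "2 * \<alpha> k * (gap (x 0 k) - C2 * ?V) \<le> 2 * \<alpha> k * (\<Sum>i<N. ?g i)"
      using C2(2) xs \<alpha>_pos[of k] by (intro mult_left_mono) auto
    moreover have "C2 * (2 * \<alpha> k * ?V) \<le> C2 * ((\<rho> k)\<^sup>2 + ?V\<^sup>2)"
    proof (intro mult_left_mono C2(1))
      have "2 * \<alpha> k * ?V \<le> 2 * \<rho> k * ?V"
        using \<alpha>_le_\<rho>[of k] disagreement_nonneg[of x k] by (intro mult_right_mono) auto
      also have "\<dots> \<le> (\<rho> k)\<^sup>2 + ?V\<^sup>2" using sum_squares_bound by blast
      finally show "2 * \<alpha> k * ?V \<le> (\<rho> k)\<^sup>2 + ?V\<^sup>2" .
    qed
    moreover have "0 \<le> N * C1 * ?V\<^sup>2" using C1(1) by simp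
    ultimately show ?thesis using 1 by (simp add: algebra_simps)
  qed
  then show ?thesis using C1(1) C2(1) by (intro exI[of _ "N * C1 + C2"]) auto
qed

lemma lyapunov_convergent:
  assumes "xs \<in> optimal"
  shows "convergent (lyapunov xs)" "summable (\<lambda>k. \<alpha> k * gap (x 0 k))"
proof -
  obtain C where C: "0 \<le> C" "\<forall>k. \<forall>xs\<in>optimal. lyapunov xs (Suc k)
     \<le> lyapunov xs k - 2 * \<alpha> k * gap (x 0 k) + C * ((\<rho> k)\<^sup>2 + (disagreement x k)\<^sup>2)"
    using lyapunov_step by blast
  let ?e = "\<lambda>k. C * ((\<rho> k)\<^sup>2 + (disagreement x k)\<^sup>2)"
  have 1: "0 \<le> lyapunov xs k" for k by (auto simp: lyapunov_def intro!: sum_nonneg add_nonneg_nonneg)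
  \<comment> \<open>The iterates may be infeasible; here exactness of the penalty takes the place of
    a saddle point inequality.\<close>
  have "0 \<le> gap (x 0 k)" for k
    using pen_le_gap[OF x_in_X, of 0 k] pen_nonneg[of "x 0 k"] N_pos by simp
  then have 2: "0 \<le> 2 * \<alpha> k * gap (x 0 k)" for k using \<alpha>_pos[of k] by simp
  have 3: "0 \<le> ?e k" for k using C by simp
  have 4: "summable ?e"
    by (intro summable_mult summable_add \<rho>_square_summable x_disagreement_square_summable)
  have 5: "lyapunov xs (Suc k) \<le> lyapunov xs k - 2 * \<alpha> k * gap (x 0 k) + ?e k" for k
    using C(2) assms by blast
  show "convergent (lyapunov xs)" by (rule almost_decreasing_convergent(1)[OF 1 2 3 5 4])
  have "summable (\<lambda>k. 2 * \<alpha> k * gap (x 0 k))" by (rule almost_decreasing_convergent(2)[OF 1 2 3 5 4])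
  then have "summable (\<lambda>k. 2 * (\<alpha> k * gap (x 0 k)))" by (simp add: mult.assoc)
  from summable_mult[OF this, of "1 / 2"] show "summable (\<lambda>k. \<alpha> k * gap (x 0 k))" by simp
qed

text \<open>The sum over the agents of a multiplier component is monotone and, being controlled by the
  Lyapunov function, bounded.\<close>
lemma w_convergent:
  assumes i: "i < N" and l: "l < M" shows "convergent (\<lambda>k. w i k l)"
proof -
  obtain xs where xs: "xs \<in> optimal" using optimum_exists by (auto simp: optimal_def)
  obtain K where K: "\<And>k. norm (lyapunov xs k) \<le> K"
    using convergent_imp_Bseq[OF lyapunov_convergent(1)[OF xs]] by (auto simp: Bseq_def)
  have le: "(w j k l - c)\<^sup>2 \<le> K" if j: "j < N" for j k
  proof -
    have "(w j k l - c)\<^sup>2 \<le> (\<Sum>l<M. (w j k l - c)\<^sup>2)" using l by (intro member_le_sum) auto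
    also have "\<dots> \<le> (norm (x j k - xs))\<^sup>2 + (\<Sum>l<M. (w j k l - c)\<^sup>2)" by simp
    also have "\<dots> \<le> lyapunov xs k" unfolding lyapunov_def
      using j by (intro member_le_sum[of j "{..<N}" "\<lambda>i. (norm (x i k - xs))\<^sup>2 + (\<Sum>l<M. (w i k l - c)\<^sup>2)"])
        (auto intro!: add_nonneg_nonneg sum_nonneg)
    also have "\<dots> \<le> K" using K[of k] by simp
    finally show ?thesis .
  qed
  let ?W = "\<lambda>k. \<Sum>j<N. w j k l"
  have "incseq ?W"
  proof (rule incseq_SucI)
    fix k
    have "?W k = (\<Sum>j<N. vw j k l)" using sum_mix[of k "\<lambda>j. w j k l"] by (simp add: vw_eq)
    also have "\<dots> \<le> ?W (Suc k)"
      using l q_nonneg[OF l] \<alpha>_pos[of k] by (intro sum_mono) (auto simp: w_step)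
    finally show "?W k \<le> ?W (Suc k)" .
  qed
  moreover have "?W k \<le> (\<Sum>j<N. c + sqrt K)" for k
  proof (rule sum_mono)
    fix j assume "j \<in> {..<N}"
    then show "w j k l \<le> c + sqrt K" using real_le_rsqrt[OF le, of j k] by simp
  qed
  ultimately obtain L where "?W \<longlonglongrightarrow> L" using incseq_convergent[of ?W] by blast
  \<comment> \<open>Vanishing disagreement passes the limit of the sum on to every agent.\<close>
  then have "(\<lambda>k. w i k l) \<longlonglongrightarrow> L / N"
    by (intro tendsto_mean_if_disagreement_tendsto_zero[where z="\<lambda>i k. w i k l"]
        disagreement_tendsto_zero w_disagreement_square_summable l i)
  then show ?thesis by (rule convergentI)
qed

text \<open>The multipliers have limits, so removing their part from the convergent Lyapunov
  function leaves a convergent distance.\<close>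

lemma distance_convergent:
  assumes "xs \<in> optimal" shows "convergent (\<lambda>k. \<Sum>i<N. (norm (x i k - xs))\<^sup>2)"
proof -
  define Wl where "Wl i l = lim (\<lambda>k. w i k l)" for i l
  have Wl: "(\<lambda>k. w i k l) \<longlonglongrightarrow> Wl i l" if "i < N" "l < M" for i l
    using w_convergent[OF that] by (simp add: Wl_def convergent_LIMSEQ_iff)
  have "(\<lambda>k. \<Sum>i<N. \<Sum>l<M. (w i k l - c)\<^sup>2) \<longlonglongrightarrow> (\<Sum>i<N. \<Sum>l<M. (Wl i l - c)\<^sup>2)"
    by (intro tendsto_intros Wl) auto
  then have "convergent (\<lambda>k. lyapunov xs k - (\<Sum>i<N. \<Sum>l<M. (w i k l - c)\<^sup>2))"
    using lyapunov_convergent(1)[OF assms] by (intro convergent_diff) (auto intro: convergentI)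
  then show ?thesis by (simp add: lyapunov_def sum.distrib)
qed

section \<open>Convergence of all agents to one optimal point\<close>

lemma gap_continuous: "continuous_on UNIV gap"
  unfolding gap_def pen_def
  by (intro continuous_intros convex_on_continuous) (auto simp: fi_convex q_convex)

text \<open>As \<open>pen\<close> is dominated by the gap, the violations vanish; then the exact
  penalty bounds the objective below by \<open>p\<close>, and the gap bounds it above.\<close>

lemma optimal_if_gap_zero: "z \<in> X \<Longrightarrow> gap z \<le> 0 \<Longrightarrow> z \<in> optimal"
proof -
  assume z: "z \<in> X" "gap z \<le> 0"
  then have pen: "pen z = 0" using pen_le_gap[of z] pen_nonneg[of z] by simp
  then have "\<forall>l<M. q l z = 0" 
    using sum_nonneg_eq_0_iff[of "{..<M}" "\<lambda>l. q l z"] q_nonneg by (auto simp: pen_def)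
  moreover have "(\<Sum>i<N. fi i z) = p"
    using z exact_penalty[of z] pen by (simp add: gap_def) (simp add: pen_def)
  ultimately show ?thesis using z by (simp add: optimal_def)
qed

text \<open>Argument of Opial type: distances to every optimal point converge, and some cluster
  point is optimal, so the distance to it has a limit, which is zero along a subsequence.\<close>

theorem iterates_converge: "\<exists>xt\<in>optimal. \<forall>i<N. x i \<longlonglongrightarrow> xt"
proof -
  have N0: "0 < N" using N_pos by simp
  obtain xs where xs: "xs \<in> optimal" using optimum_exists by (auto simp: optimal_def)
  obtain f :: "nat \<Rightarrow> nat" where f: "\<And>n. n \<le> f n" "\<And>n. gap (x 0 (f n)) < 1 / (n + 1)"
    using vanishing_along_times[OF \<alpha>_pos \<alpha>_not_summable lyapunov_convergent(2)[OF xs]] by blast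
  obtain xt r where xt: "xt \<in> X" and r: "strict_mono r" and lim: "((\<lambda>n. x 0 (f n)) \<circ> r) \<longlonglongrightarrow> xt"
    using X_compact x_in_X[OF N0] unfolding compact_def by (metis (mono_tags))
  \<comment> \<open>\<open>f\<close> need not be monotone, so its composite with \<open>r\<close> is
    handled as a filter limit.\<close>
  have fr: "filterlim (\<lambda>n. f (r n)) at_top sequentially"
    using order.trans[OF seq_suble[OF r] f(1)]
    by (intro filterlim_at_top_mono[OF filterlim_ident] always_eventually) auto
  have x0: "(\<lambda>n. x 0 (f (r n))) \<longlonglongrightarrow> xt" using lim by (simp add: comp_def)
  have "(\<lambda>n. gap (x 0 (f (r n)))) \<longlonglongrightarrow> gap xt"
    using gap_continuous x0 by (intro continuous_on_tendsto_compose[of UNIV gap]) auto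
  moreover have "(\<lambda>n. 1 / (real (r n) + 1)) \<longlonglongrightarrow> 0"
    using LIMSEQ_subseq_LIMSEQ[OF LIMSEQ_inverse_real_of_nat r]
    by (simp add: comp_def inverse_eq_divide add.commute)
  ultimately have "gap xt \<le> 0"
    by (rule LIMSEQ_le) (use f(2) less_imp_le in blast)
  then have opt: "xt \<in> optimal" using xt optimal_if_gap_zero by blast
  \<comment> \<open>Convergence of the distance is now applied to the cluster point itself.\<close>
  obtain d where d: "(\<lambda>k. \<Sum>i<N. (norm (x i k - xt))\<^sup>2) \<longlonglongrightarrow> d"
    using distance_convergent[OF opt] unfolding convergent_def by blast
  \<comment> \<open>All agents share the cluster point of agent 0 because the disagreement
    vanishes.\<close>
  have "(\<lambda>n. x i (f (r n))) \<longlonglongrightarrow> xt" if i: "i < N" for i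
  proof -
    have "(\<lambda>k. x i k - x 0 k) \<longlonglongrightarrow> 0"
    proof (rule Lim_null_comparison)
      show "disagreement x \<longlonglongrightarrow> 0"
        by (rule disagreement_tendsto_zero[OF x_disagreement_square_summable])
      show "\<forall>\<^sub>F k in sequentially. norm (x i k - x 0 k) \<le> disagreement x k"
        by (intro always_eventually allI norm_diff_le_disagreement i N0)
    qed
    then have "(\<lambda>n. x i (f (r n)) - x 0 (f (r n))) \<longlonglongrightarrow> 0" using fr by (rule filterlim_compose)
    from tendsto_add[OF this x0] show ?thesis by simp
  qed
  then have "(\<lambda>n. \<Sum>i<N. (norm (x i (f (r n)) - xt))\<^sup>2) \<longlonglongrightarrow> (\<Sum>i<N. (norm (xt - xt))\<^sup>2)"
    by (intro tendsto_intros) auto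
  moreover have "(\<lambda>n. \<Sum>i<N. (norm (x i (f (r n)) - xt))\<^sup>2) \<longlonglongrightarrow> d"
    using d fr by (rule filterlim_compose)
  ultimately have "(\<Sum>i<N. (norm (xt - xt))\<^sup>2) = d" by (rule LIMSEQ_unique)
  then have "d = 0" by simp
  have "x i \<longlonglongrightarrow> xt" if i: "i < N" for i
  proof -
    have "(\<lambda>k. (norm (x i k - xt))\<^sup>2) \<longlonglongrightarrow> 0"
    proof (rule Lim_null_comparison)
      show "\<forall>\<^sub>F k in sequentially. norm ((norm (x i k - xt))\<^sup>2) \<le> (\<Sum>i<N. (norm (x i k - xt))\<^sup>2)"
      proof (intro always_eventually allI)
        fix k
        show "norm ((norm (x i k - xt))\<^sup>2) \<le> (\<Sum>i<N. (norm (x i k - xt))\<^sup>2)"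
          using i member_le_sum[of i "{..<N}" "\<lambda>i. (norm (x i k - xt))\<^sup>2"] by simp
      qed
    qed (use d \<open>d = 0\<close> in simp)
    from tendsto_real_sqrt[OF this] have "(\<lambda>k. norm (x i k - xt)) \<longlonglongrightarrow> 0" by simp
    then show ?thesis by (simp add: tendsto_norm_zero_iff LIM_zero_iff)
  qed
  then show ?thesis using opt by blast
qed

text \<open>A state moves by a projected step plus a mixing displacement, both square summable, and
  the objectives are Lipschitz on \<open>X\<close>. These increments are what perturbs the trackers
  \<open>y\<close>.\<close>

lemma increments_square_summable:
  "\<exists>\<epsilon>. summable (\<lambda>k. (\<epsilon> k)\<^sup>2) \<and> (\<forall>k. \<forall>i<N. \<bar>fi i (x i (Suc k)) - fi i (x i k)\<bar> \<le> \<epsilon> k)"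
proof -
  obtain L where L: "0 \<le> L" "\<forall>i<N. \<forall>z\<in>X. \<forall>y\<in>X. fi i z \<le> fi i y + L * norm (z - y)"
    using fi_lipschitz by blast
  obtain C where C: "0 \<le> C" "\<forall>k. \<forall>i<N. \<alpha> k * norm (direction i k) \<le> C * \<rho> k"
    using direction_bounded by blast
  let ?\<epsilon> = "\<lambda>k. L * (C * \<rho> k + disagreement x k)"
  have "\<bar>fi i (x i (Suc k)) - fi i (x i k)\<bar> \<le> ?\<epsilon> k" if i: "i < N" for i k
  proof -
    have "norm (x i (Suc k) - x i k) \<le> norm (x i (Suc k) - vx i k) + norm (vx i k - x i k)"
      by norm
    also have "\<dots> \<le> C * \<rho> k + disagreement x k"
      using order.trans[OF x_perturbation[OF i]] C(2) i mix_near[OF i i, of k x]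
      unfolding vx_eq[symmetric] by (intro add_mono) auto
    finally have "L * norm (x i (Suc k) - x i k) \<le> ?\<epsilon> k" using L(1) by (rule mult_left_mono)
    moreover have "fi i (x i (Suc k)) \<le> fi i (x i k) + L * norm (x i (Suc k) - x i k)"
      "fi i (x i k) \<le> fi i (x i (Suc k)) + L * norm (x i k - x i (Suc k))"
      using L(2) i x_in_X[OF i] by blast+
    ultimately show ?thesis by (simp add: norm_minus_commute)
  qed
  moreover have "summable (\<lambda>k. (?\<epsilon> k)\<^sup>2)"
  proof (rule summable_comparison_test')
    show "summable (\<lambda>k. L\<^sup>2 * (2 * (C\<^sup>2 * (\<rho> k)\<^sup>2) + 2 * (disagreement x k)\<^sup>2))"
      by (intro summable_mult summable_add \<rho>_square_summable x_disagreement_square_summable)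
    show "norm ((?\<epsilon> k)\<^sup>2) \<le> L\<^sup>2 * (2 * (C\<^sup>2 * (\<rho> k)\<^sup>2) + 2 * (disagreement x k)\<^sup>2)" if "0 \<le> k" for k
    proof -
      have "(C * \<rho> k + disagreement x k)\<^sup>2 \<le> 2 * (C * \<rho> k)\<^sup>2 + 2 * (disagreement x k)\<^sup>2"
        using sum_squares_bound[of "C * \<rho> k" "disagreement x k"] by (simp add: power2_sum)
      then have "L\<^sup>2 * (C * \<rho> k + disagreement x k)\<^sup>2 \<le> L\<^sup>2 * (2 * (C * \<rho> k)\<^sup>2 + 2 * (disagreement x k)\<^sup>2)"
        by (intro mult_left_mono) auto
      then show ?thesis by (simp add: power_mult_distrib)
    qed
  qed
  ultimately show ?thesis by (intro exI[of _ ?\<epsilon>]) auto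
qed

end

section \<open>Convergence\<close>

lemma sum_lessThan_add_split:
  fixes \<phi> :: "nat \<Rightarrow> 'b::comm_monoid_add"
  shows "(\<Sum>l<m + n. \<phi> l) = (\<Sum>l<m. \<phi> l) + (\<Sum>l<n. \<phi> (m + l))"
  by (induction n) (auto simp: add.assoc)

lemma convex_on_sum_lessThan:
  fixes F :: "nat \<Rightarrow> 'a::real_vector \<Rightarrow> real"
  assumes "\<forall>i<n. convex_on UNIV (F i)"
  shows "convex_on UNIV (\<lambda>z. \<Sum>i<n. F i z)"
  using assms
proof (induction n)
  case (Suc n)
  then show ?case by (auto intro!: convex_on_add)
qed (simp add: convex_on_def)

text \<open>Each point of \<open>X\<close> has a feasible point within \<open>C\<close> times its
  violation, and \<open>F\<close> changes by at most \<open>L\<close> times that distance, so the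
  multiplier \<open>L * C\<close> works.\<close>

lemma exact_penalty_exists:
  fixes X :: "'a::euclidean_space set" and A :: "nat \<Rightarrow> 'a"
  assumes X: "compact X" "convex X" and xt: "xt \<in> rel_interior X" "\<forall>l<\<nu>. inner (A l) xt = b l"
    and g: "\<forall>l<m. convex_on UNIV (g l)"
    and xb: "xb \<in> X" "\<forall>l<m. g l xb < 0" "\<forall>l<\<nu>. inner (A l) xb = b l"
    and F: "convex_on UNIV F"
    and p: "\<forall>z\<in>feasible_set X m g \<nu> (\<lambda>l z. inner (A l) z - b l). p \<le> F z"
  shows "\<exists>\<kappa>\<ge>0. \<forall>z\<in>X. p \<le> F z + \<kappa> * ((\<Sum>l<m. max 0 (g l z)) + (\<Sum>l<\<nu>. \<bar>inner (A l) z - b l\<bar>))"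
proof -
  obtain C where C: "0 \<le> C"
    "\<forall>x\<in>X. \<exists>x'\<in>feasible_set X m g \<nu> (\<lambda>l z. inner (A l) z - b l).
      norm (x - x') \<le> C * ((\<Sum>l<m. max 0 (g l x)) + (\<Sum>l<\<nu>. \<bar>inner (A l) x - b l\<bar>))"
    using feasible_set_error_bound[OF X xt g xb] by blast
  obtain L where L: "0 \<le> L" "\<And>z w. z \<in> X \<Longrightarrow> w \<in> X \<Longrightarrow> \<bar>F z - F w\<bar> \<le> L * norm (z - w)"
    using convex_on_UNIV_lipschitz[OF F X(1)] by blast
  have "p \<le> F z + (L * C) * ((\<Sum>l<m. max 0 (g l z)) + (\<Sum>l<\<nu>. \<bar>inner (A l) z - b l\<bar>))"
    if z: "z \<in> X" for z
  proof -
    let ?P = "(\<Sum>l<m. max 0 (g l z)) + (\<Sum>l<\<nu>. \<bar>inner (A l) z - b l\<bar>)"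
    obtain z' where z': "z' \<in> feasible_set X m g \<nu> (\<lambda>l z. inner (A l) z - b l)"
      "norm (z - z') \<le> C * ?P" using C(2) z by blast
    have "p \<le> F z'" using p z' by blast
    also have "\<dots> \<le> F z + L * norm (z - z')"
      using L(2)[OF z, of z'] z' by (auto simp: feasible_set_def)
    also have "\<dots> \<le> F z + L * (C * ?P)" using z'(2) L(1) by (intro add_left_mono mult_left_mono)
    finally show ?thesis by (simp add: mult.assoc)
  qed
  then show ?thesis using L(1) C(1) by (intro exI[of _ "L * C"]) auto
qed

lemma opt_set_nonempty:
  fixes X :: "'a::euclidean_space set"
  assumes X: "compact X" and fi: "\<forall>i<N. convex_on UNIV (fi i)"
    and g: "\<forall>l<m. convex_on UNIV (g l)" and h: "\<forall>l<\<nu>. continuous_on UNIV (h l)"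
    and ne: "feasible_set X m g \<nu> h \<noteq> {}"
  shows "opt_set N fi X m g \<nu> h \<noteq> {}"
    and "\<forall>z\<in>feasible_set X m g \<nu> h. opt_value N fi X m g \<nu> h \<le> (\<Sum>i<N. fi i z)"
proof -
  let ?S = "feasible_set X m g \<nu> h" and ?F = "\<lambda>z. \<Sum>i<N. fi i z"
  have "?S = X \<inter> ((\<Inter>l\<in>{..<m}. {z. g l z \<le> 0}) \<inter> (\<Inter>l\<in>{..<\<nu>}. {z. h l z = 0}))"
    by (auto simp: feasible_set_def)
  moreover have "closed {z. g l z \<le> 0}" if "l < m" for l
    using convex_on_continuous[OF open_UNIV, of "g l"] g that
    by (intro closed_Collect_le) (auto intro: continuous_intros)
  moreover have "closed {z. h l z = 0}" if "l < \<nu>" for l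
    using h that by (intro closed_Collect_eq) (auto intro: continuous_intros)
  ultimately have "compact ?S"
    using X by (simp only:) (intro compact_Int_closed closed_Int closed_INT ballI; simp)
  moreover have "continuous_on ?S ?F"
    using convex_on_continuous[OF open_UNIV convex_on_sum_lessThan[OF fi]] continuous_on_subset by blast
  ultimately obtain z0 where z0: "z0 \<in> ?S" "\<forall>z\<in>?S. ?F z0 \<le> ?F z"
    using continuous_attains_inf[OF _ ne] by blast
  have "opt_value N fi X m g \<nu> h = ?F z0"
    unfolding opt_value_def using z0 by (intro cInf_eq_minimum) auto
  then show "opt_set N fi X m g \<nu> h \<noteq> {}"
    and "\<forall>z\<in>?S. opt_value N fi X m g \<nu> h \<le> ?F z"
    using z0 by (auto simp: opt_set_def)
qed

text \<open>Expanding the square yields the three given series after a shift by one, since the sum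
  strictly before \<open>Suc k\<close> is the sum up to \<open>k\<close>.\<close>

lemma step_times_partial_sum_square_summable:
  fixes \<alpha> :: "nat \<Rightarrow> real"
  assumes "summable (\<lambda>k. (\<alpha> k)\<^sup>2)" "summable (\<lambda>k. (\<alpha> (Suc k))\<^sup>2 * (\<Sum>l\<le>k. \<alpha> l))"
    "summable (\<lambda>k. (\<alpha> (Suc k))\<^sup>2 * (\<Sum>l\<le>k. \<alpha> l)\<^sup>2)"
  shows "summable (\<lambda>k. (\<alpha> k * (1 + (\<Sum>l<k. \<alpha> l)))\<^sup>2)"
proof -
  have "summable (\<lambda>k. (\<alpha> (Suc k))\<^sup>2 + 2 * ((\<alpha> (Suc k))\<^sup>2 * (\<Sum>l\<le>k. \<alpha> l))
      + (\<alpha> (Suc k))\<^sup>2 * (\<Sum>l\<le>k. \<alpha> l)\<^sup>2)"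
    using assms by (intro summable_add summable_mult)
      (simp_all add: summable_Suc_iff[of "\<lambda>k. (\<alpha> k)\<^sup>2"])
  also have "(\<lambda>k. (\<alpha> (Suc k))\<^sup>2 + 2 * ((\<alpha> (Suc k))\<^sup>2 * (\<Sum>l\<le>k. \<alpha> l))
      + (\<alpha> (Suc k))\<^sup>2 * (\<Sum>l\<le>k. \<alpha> l)\<^sup>2) = (\<lambda>k. (\<alpha> (Suc k) * (1 + (\<Sum>l<Suc k. \<alpha> l)))\<^sup>2)"
    unfolding lessThan_Suc_atMost by (simp add: power2_eq_square algebra_simps)
  finally show ?thesis
    by (simp only: summable_Suc_iff[of "\<lambda>k. (\<alpha> k * (1 + (\<Sum>l<k. \<alpha> l)))\<^sup>2"])
qed

text \<open>The trackers start at time 1, so they live on the same network with its clock advanced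
  by one.\<close>

lemma (in balanced_network) balanced_network_shift: "balanced_network N (\<lambda>k. a (Suc k)) \<eta> B"
proof unfold_locales
  fix k0
  have "comm_edges N (\<lambda>k. a (Suc k)) (k0 + k) = comm_edges N a (Suc k0 + k)" for k
    by (simp add: comm_edges_def)
  then show "strongly_connected_on N (\<Union>k<B. comm_edges N (\<lambda>k. a (Suc k)) (k0 + k))"
    using connected[of "Suc k0"] by simp
qed (use N_pos weight_nonneg \<eta>_pos self_weight edge_weight row_sum col_sum in auto)

text \<open>Dynamic average consensus: the sum of the trackers y equals the sum of the tracked signals.\<close>
lemma (in balanced_network) tracking_tendsto:
  fixes y r :: "nat \<Rightarrow> nat \<Rightarrow> real"
  assumes init: "\<And>i. i < N \<Longrightarrow> y i 1 = N * r i 0"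
    and step: "\<And>i k. i < N \<Longrightarrow> 1 \<le> k \<Longrightarrow> y i (Suc k) = (\<Sum>j<N. a k i j * y j k) + N * (r i k - r i (k - 1))"
    and \<epsilon>: "summable (\<lambda>k. (\<epsilon> k)\<^sup>2)" "\<And>i k. i < N \<Longrightarrow> \<bar>r i (Suc k) - r i k\<bar> \<le> \<epsilon> k"
    and lim: "\<And>i. i < N \<Longrightarrow> r i \<longlonglongrightarrow> R i" and i: "i < N"
  shows "y i \<longlonglongrightarrow> (\<Sum>j<N. R j)"
proof -
  interpret shifted: balanced_network N "\<lambda>k. a (Suc k)" \<eta> B by (rule balanced_network_shift)
  let ?y = "\<lambda>i k. y i (Suc k)"
  have "summable (\<lambda>k. (shifted.disagreement ?y k)\<^sup>2)"
  proof (rule shifted.disagreement_square_summable)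
    show "norm (y j (Suc (Suc k)) - (\<Sum>l<N. a (Suc k) j l *\<^sub>R y l (Suc k))) \<le> N * \<epsilon> k" if "j < N" for j k
      using \<epsilon>(2)[OF that, of k] step[OF that, of "Suc k"] by (simp add: abs_mult mult_left_mono)
    show "summable (\<lambda>k. (N * \<epsilon> k)\<^sup>2)" using \<epsilon>(1) by (simp add: power_mult_distrib summable_mult)
  qed
  then have "shifted.disagreement ?y \<longlonglongrightarrow> 0" by (rule shifted.disagreement_tendsto_zero)
  \<comment> \<open>Mixing conserves totals and the increments telescope; trackers at time
    \<open>Suc k\<close> carry the signals at time \<open>k\<close>.\<close>
  moreover have "(\<Sum>j<N. y j (Suc k)) = N * (\<Sum>j<N. r j k)" for k
  proof (induction k)
    case 0
    then show ?case using init by (simp add: sum_distrib_left)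
  next
    case (Suc k)
    have "(\<Sum>j<N. y j (Suc (Suc k))) = (\<Sum>j<N. (\<Sum>l<N. a (Suc k) j l *\<^sub>R y l (Suc k)) + N * (r j (Suc k) - r j k))"
      by (intro sum.cong) (auto simp: step)
    also have "\<dots> = (\<Sum>j<N. y j (Suc k)) + N * (\<Sum>j<N. r j (Suc k) - r j k)"
      unfolding sum.distrib sum_mix by (simp add: sum_distrib_left)
    finally show ?case using Suc by (simp add: sum_subtractf right_diff_distrib)
  qed
  moreover have "(\<lambda>k. N * (\<Sum>j<N. r j k)) \<longlonglongrightarrow> N * (\<Sum>j<N. R j)"
    by (intro tendsto_intros lim) auto
  \<comment> \<open>The scaling of the signals by \<open>N\<close> turns the mean of the trackers
    into the sum of the signals.\<close>
  ultimately have "?y i \<longlonglongrightarrow> N * (\<Sum>j<N. R j) / N"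
    by (intro shifted.tendsto_mean_if_disagreement_tendsto_zero i) auto
  then have "?y i \<longlonglongrightarrow> (\<Sum>j<N. R j)" using N_pos by simp
  then show ?thesis by (rule LIMSEQ_imp_Suc)
qed

section \<open>Reduction of the algorithm to the penalty iteration\<close>

theorem mainTheorem12:
  fixes N m \<nu> :: nat
    and fi :: "nat \<Rightarrow> 'a::euclidean_space \<Rightarrow> real"
    and X :: "'a set"
    and g :: "nat \<Rightarrow> 'a \<Rightarrow> real"
    and av :: "nat \<Rightarrow> 'a" and bv :: "nat \<Rightarrow> real"
    and h :: "nat \<Rightarrow> 'a \<Rightarrow> real"
    and a :: "nat \<Rightarrow> nat \<Rightarrow> nat \<Rightarrow> real"
    and \<alpha> :: "nat \<Rightarrow> real" and s :: "nat \<Rightarrow> real"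
    and x :: "nat \<Rightarrow> nat \<Rightarrow> 'a" and y :: "nat \<Rightarrow> nat \<Rightarrow> real"
    and mu :: "nat \<Rightarrow> nat \<Rightarrow> nat \<Rightarrow> real" and lam :: "nat \<Rightarrow> nat \<Rightarrow> nat \<Rightarrow> real"
    and vx :: "nat \<Rightarrow> nat \<Rightarrow> 'a" and vy :: "nat \<Rightarrow> nat \<Rightarrow> real"
    and vmu :: "nat \<Rightarrow> nat \<Rightarrow> nat \<Rightarrow> real" and vla :: "nat \<Rightarrow> nat \<Rightarrow> nat \<Rightarrow> real"
    and Df :: "nat \<Rightarrow> nat \<Rightarrow> 'a"
    and Dg :: "nat \<Rightarrow> nat \<Rightarrow> nat \<Rightarrow> 'a" and Dh :: "nat \<Rightarrow> nat \<Rightarrow> nat \<Rightarrow> 'a"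
    and S :: "nat \<Rightarrow> nat \<Rightarrow> 'a"
  assumes N_pos: "N \<ge> 1"
    (* problem data *)
    and fi_convex: "\<forall>i<N. convex_on UNIV (fi i)"
    and X_ne: "X \<noteq> {}" and X_compact: "compact X" and X_convex: "convex X"
    and g_convex: "\<forall>l<m. convex_on UNIV (g l)"
    and h_def: "\<forall>l z. h l z = inner (av l) z - bv l"
    and feasible_ne: "feasible_set X m g \<nu> h \<noteq> {}"
    (* Slater condition *)
    and slater1: "\<exists>xb\<in>X. (\<forall>l<m. g l xb < 0) \<and> (\<forall>l<\<nu>. h l xb = 0)"
    and slater2: "\<exists>xt\<in>rel_interior X. \<forall>l<\<nu>. h l xt = 0"
    (* network assumptions *)
    and weights_nonneg: "\<forall>k i j. i < N \<longrightarrow> j < N \<longrightarrow> a k i j \<ge> 0"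
    and nondegenerate: "\<exists>\<eta>>0. \<forall>k. \<forall>i<N. a k i i \<ge> \<eta> \<and>
          (\<forall>j<N. j \<noteq> i \<longrightarrow> a k i j = 0 \<or> (\<eta> \<le> a k i j \<and> a k i j \<le> 1))"
    and balanced_row: "\<forall>k. \<forall>i<N. (\<Sum>j<N. a k i j) = 1"
    and balanced_col: "\<forall>k. \<forall>j<N. (\<Sum>i<N. a k i j) = 1"
    and periodic_conn: "\<exists>B::nat. B \<ge> 1 \<and> (\<forall>k0.
          strongly_connected_on N (\<Union>k<B. comm_edges N a (k0 + k)))"
    (* step sizes *)
    and alpha_pos: "\<forall>k. \<alpha> k > 0"
    and s_def: "\<forall>k. s k = (\<Sum>l\<le>k. \<alpha> l)"
    and alpha_lim: "\<alpha> \<longlonglongrightarrow> 0"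
    and alpha_not_summable: "\<not> summable \<alpha>"
    and alpha_sq_summable: "summable (\<lambda>k. (\<alpha> k)\<^sup>2)"
    and alpha_s_lim: "(\<lambda>k. \<alpha> (Suc k) * s k) \<longlonglongrightarrow> 0"
    and alpha_s_summable: "summable (\<lambda>k. (\<alpha> (Suc k))\<^sup>2 * s k)"
    and alpha_s2_summable: "summable (\<lambda>k. (\<alpha> (Suc k))\<^sup>2 * (s k)\<^sup>2)"
    (* DPPDS algorithm: initialization *)
    and x0: "\<forall>i<N. x i 0 \<in> X"
    and mu0: "\<forall>i<N. \<forall>l<m. mu i 0 l \<ge> 0"
    and la0: "\<forall>i<N. \<forall>l<\<nu>. lam i 0 l \<ge> 0"
    and y1: "\<forall>i<N. y i 1 = real N * fi i (x i 0)"
    (* consensus steps *)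
    and vx_def: "\<forall>i k. vx i k = (\<Sum>j<N. a k i j *\<^sub>R x j k)"
    and vy_def: "\<forall>i k. vy i k = (\<Sum>j<N. a k i j * y j k)"
    and vmu_def: "\<forall>i k l. vmu i k l = (\<Sum>j<N. a k i j * mu j k l)"
    and vla_def: "\<forall>i k l. vla i k l = (\<Sum>j<N. a k i j * lam j k l)"
    (* subgradients *)
    and Df_sub: "\<forall>i<N. \<forall>k. is_subgradient (fi i) (vx i k) (Df i k)"
    and Dg_sub: "\<forall>i<N. \<forall>k. \<forall>l<m. is_subgradient (\<lambda>z. max 0 (g l z)) (vx i k) (Dg i k l)"
    and Dh_sub: "\<forall>i<N. \<forall>k. \<forall>l<\<nu>. is_subgradient (\<lambda>z. \<bar>h l z\<bar>) (vx i k) (Dh i k l)"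
    and S_def: "\<forall>i k. S i k = Df i k + (\<Sum>l<m. vmu i k l *\<^sub>R Dg i k l)
                                      + (\<Sum>l<\<nu>. vla i k l *\<^sub>R Dh i k l)"
    (* update rules *)
    and x_upd: "\<forall>i<N. \<forall>k. x i (Suc k) = closest_point X (vx i k - \<alpha> k *\<^sub>R S i k)"
    and mu_upd: "\<forall>i<N. \<forall>k. \<forall>l<m. mu i (Suc k) l = vmu i k l + \<alpha> k * max 0 (g l (vx i k))"
    and la_upd: "\<forall>i<N. \<forall>k. \<forall>l<\<nu>. lam i (Suc k) l = vla i k l + \<alpha> k * \<bar>h l (vx i k)\<bar>"
    and y_upd: "\<forall>i<N. \<forall>k\<ge>1. y i (Suc k) = vy i k + real N * (fi i (x i k) - fi i (x i (k - 1)))"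
  shows "\<exists>xt\<in>opt_set N fi X m g \<nu> h.
           (\<forall>i<N. (\<lambda>k. norm (x i k - xt)) \<longlonglongrightarrow> 0) \<and>
           (\<forall>i<N. (\<lambda>k. \<bar>y i k - opt_value N fi X m g \<nu> h\<bar>) \<longlonglongrightarrow> 0)"
proof -
  let ?p = "opt_value N fi X m g \<nu> h" and ?F = "\<lambda>z. \<Sum>i<N. fi i z"
  have h_eq: "h = (\<lambda>l z. inner (av l) z - bv l)" using h_def by blast
  obtain \<eta> where \<eta>: "\<eta> > 0" "\<forall>k. \<forall>i<N. a k i i \<ge> \<eta> \<and>
      (\<forall>j<N. j \<noteq> i \<longrightarrow> a k i j = 0 \<or> (\<eta> \<le> a k i j \<and> a k i j \<le> 1))" using nondegenerate by blast
  obtain B :: nat where B: "\<forall>k0. strongly_connected_on N (\<Union>k<B. comm_edges N a (k0 + k))"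
    using periodic_conn by blast
  interpret net: balanced_network N a \<eta> B
  proof unfold_locales
    \<comment> \<open>Off the diagonal a positive weight is not zero, hence at least
      \<open>\<eta>\<close>; on the diagonal this is the bound on the self weight.\<close>
    show "\<eta> \<le> a k i j" if "i < N" "j < N" "0 < a k i j" for i j k
      using \<eta>(2) that by (cases "i = j") force+
  qed (use N_pos weights_nonneg \<eta> balanced_row balanced_col B in auto)

  have h_cont: "\<forall>l<\<nu>. continuous_on UNIV (h l)" by (auto simp: h_eq intro!: continuous_intros)
  note opt = opt_set_nonempty[OF X_compact fi_convex g_convex h_cont feasible_ne]
  obtain xb where xb: "xb \<in> X" "\<forall>l<m. g l xb < 0" "\<forall>l<\<nu>. inner (av l) xb = bv l"
    using slater1 by (auto simp: h_eq)
  obtain xr where xr: "xr \<in> rel_interior X" "\<forall>l<\<nu>. inner (av l) xr = bv l"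
    using slater2 by (auto simp: h_eq)
  obtain \<kappa> where \<kappa>: "0 \<le> \<kappa>"
    "\<forall>z\<in>X. ?p \<le> ?F z + \<kappa> * ((\<Sum>l<m. max 0 (g l z)) + (\<Sum>l<\<nu>. \<bar>h l z\<bar>))"
    using exact_penalty_exists[OF X_compact X_convex xr g_convex xb
        convex_on_sum_lessThan[OF fi_convex] opt(2)[unfolded h_eq]] by (auto simp: h_eq)

  \<comment> \<open>Indices below \<open>m\<close> carry the inequalities, those from
    \<open>m\<close> on the equations, shifted by \<open>m\<close>.\<close>
  define q where "q l = (if l < m then (\<lambda>z. max 0 (g l z)) else (\<lambda>z. \<bar>h (l - m) z\<bar>))" for l
  define w where "w i k l = (if l < m then mu i k l else lam i k (l - m))" for i k l
  define vw where "vw i k l = (if l < m then vmu i k l else vla i k (l - m))" for i k l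
  define Dq where "Dq i k l = (if l < m then Dg i k l else Dh i k (l - m))" for i k l
  have opt_iff: "(\<forall>l<m + \<nu>. q l z = 0) \<longleftrightarrow> (\<forall>l<m. g l z \<le> 0) \<and> (\<forall>l<\<nu>. h l z = 0)" for z
  proof safe
    fix l assume q0: "\<forall>l<m + \<nu>. q l z = 0"
    show "g l z \<le> 0" if "l < m" using q0[rule_format, of l] that by (simp add: q_def)
    show "h l z = 0" if "l < \<nu>" using q0[rule_format, of "m + l"] that by (simp add: q_def)
  next
    fix l assume "\<forall>l<m. g l z \<le> 0" "\<forall>l<\<nu>. h l z = 0" "l < m + \<nu>"
    then show "q l z = 0" by (auto simp: q_def max_def)
  qed
  interpret pd: penalty_primal_dual N a \<eta> B X fi "m + \<nu>" q \<kappa> ?p \<alpha> x vx w vw Df Dq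
  proof unfold_locales
    show "convex_on UNIV (q l)" if "l < m + \<nu>" for l
      using g_convex that by (auto simp: q_def h_eq intro: convex_on_pos_part convex_on_abs_affine)
    show "?p \<le> ?F z + \<kappa> * (\<Sum>l<m + \<nu>. q l z)" if "z \<in> X" for z
      using \<kappa>(2) that by (simp add: sum_lessThan_add_split q_def)
    show "\<exists>z\<in>X. (\<forall>l<m + \<nu>. q l z = 0) \<and> ?F z = ?p"
      using opt(1) by (auto simp: opt_iff opt_set_def feasible_set_def)
    show "summable (\<lambda>k. (\<alpha> k * (1 + (\<Sum>l<k. \<alpha> l)))\<^sup>2)"
      using alpha_sq_summable alpha_s_summable alpha_s2_summable
      by (intro step_times_partial_sum_square_summable) (auto simp: s_def)
    show "is_subgradient (q l) (vx i k) (Dq i k l)" if "i < N" "l < m + \<nu>" for i l k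
      using Dg_sub Dh_sub that by (auto simp: q_def Dq_def)
    show "x i (Suc k) = closest_point X (vx i k - \<alpha> k *\<^sub>R (Df i k + (\<Sum>l<m + \<nu>. vw i k l *\<^sub>R Dq i k l)))"
      if "i < N" for i k
      using x_upd S_def that by (simp add: sum_lessThan_add_split vw_def Dq_def add.assoc)
    show "w i (Suc k) l = vw i k l + \<alpha> k * q l (vx i k)" if "i < N" "l < m + \<nu>" for i l k
      using mu_upd la_upd that by (auto simp: q_def w_def vw_def)
    show "0 \<le> w i 0 l" if "i < N" "l < m + \<nu>" for i l
      using mu0 la0 that by (auto simp: w_def)
    show "vw i k l = (\<Sum>j<N. a k i j * w j k l)" for i k l
      using vmu_def vla_def by (simp add: vw_def w_def)
  qed (use X_compact X_convex fi_convex \<kappa>(1) alpha_pos alpha_not_summable x0 vx_def Df_sub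
      in \<open>auto simp: q_def\<close>)

  obtain xt where xt: "xt \<in> pd.optimal" "\<forall>i<N. x i \<longlonglongrightarrow> xt" using pd.iterates_converge by blast
  have xt_opt: "xt \<in> opt_set N fi X m g \<nu> h"
    using xt(1) unfolding pd.optimal_def opt_iff by (auto simp: opt_set_def feasible_set_def)
  obtain \<epsilon> where \<epsilon>: "summable (\<lambda>k. (\<epsilon> k)\<^sup>2)"
    "\<forall>k. \<forall>i<N. \<bar>fi i (x i (Suc k)) - fi i (x i k)\<bar> \<le> \<epsilon> k" using pd.increments_square_summable by blast
  \<comment> \<open>The tracked signals are the local objective values along the iterates, whose
    limits add up to the objective at \<open>xt\<close>.\<close>
  have y_lim: "y i \<longlonglongrightarrow> ?F xt" if i: "i < N" for i
  proof (rule net.tracking_tendsto[where r="\<lambda>i k. fi i (x i k)"])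
    show "(\<lambda>k. fi j (x j k)) \<longlonglongrightarrow> fi j xt" if "j < N" for j
      using convex_on_continuous[OF open_UNIV, of "fi j"] fi_convex xt(2) that
      by (intro continuous_on_tendsto_compose[of UNIV "fi j"]) auto
  qed (use y1 y_upd vy_def \<epsilon> i in auto)
  have "?F xt = ?p" using xt_opt by (simp add: opt_set_def)
  with y_lim xt xt_opt show ?thesis
    by (intro bexI[of _ xt]) (auto intro!: tendsto_rabs_zero LIM_zero tendsto_norm_zero)
qed

end
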